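(* Let $u\in S$, and let $\tilde f^n_u$, $\tilde f^n_{u^c}$ and $\tilde f^n$ be the realizations (sample paths, for one fixed outcome $\omega\in\Omega_Z$) of the random processes $f^n_u$, $f^n_{u^c}=f^n-f^n_u$ and $f^n$ described in the context. Define the sensitivity measure $$s_u^f = \frac{V(\tilde f^n_u(\mathbf{X}_u)) + \mathrm{Cov}(\tilde f^n_u(\mathbf{X}_u),\tilde f^n_{u^c}(\mathbf{X}))}{V(\tilde f^n(\mathbf{X}))},$$ and assume $V(\tilde f^n(\mathbf{X}))\neq 0$ and $\mathbb{E}[\tilde f^n_v(\mathbf{X}_v)^4]<\infty$ for all $v\in S$. Let $\mathbf{t}^1,\mathbf{t}^2,\dots$ be i.i.d. with the distribution $P_{\mathbf{X}}$ of $\mathbf{X}$, and for $m\ge1$ let $$s_{u,m}^f = \frac{\frac1m\sum_{j=1}^m \tilde f^n_u(\mathbf{t}^j_u)^2 - \big(\bar{\tilde f}{}^n_u\big)^2 + \frac1m\sum_{j=1}^m \tilde f^n_u(\mathbf{t}^j_u)\tilde f^n_{u^c}(\mathbf{t}^j) - \bar{\tilde f}{}^n_u\,\bar{\tilde f}{}^n_{u^c}}{\frac1m\sum_{j=1}^m\tilde f^n(\mathbf{t}^j)^2 - \Big(\frac1m\sum_{j=1}^m\tilde f^n(\mathbf{t}^j)\Big)^2},$$ where $\bar{\tilde f}{}^n_u=\frac1m\sum_{j=1}^m\tilde f^n_u(\mathbf{t}^j_u)$ and $\bar{\tilde f}{}^n_{u^c}=\frac1m\sum_{j=1}^m\tilde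 f^n_{u^c}(\mathbf{t}^j)$. Then, as $m\to\infty$, $$\sqrt{m}\,\big(s_{u,m}^f - s_u^f\big)\ \xrightarrow{\ \mathcal{L}\ }\ \mathcal{N}\big(0,\ {}^t(\nabla\phi(\boldsymbol{\mu}))\,\boldsymbol{\Gamma}\,\nabla\phi(\boldsymbol{\mu})\big),$$ where $\boldsymbol{\mu}=\mathbb{E}(\mathbf{U})$ is the mean vector and $\boldsymbol{\Gamma}=V(\mathbf{U})$ the covariance matrix of the random vector in $\mathbb{R}^6$ $$\mathbf{U} = \big(\tilde f^n_u(\mathbf{X}_u),\ \tilde f^n_{u^c}(\mathbf{X}),\ \tilde f^n(\mathbf{X}),\ \tilde f^n_u(\mathbf{X}_u)^2,\ \tilde f^n(\mathbf{X})^2,\ \tilde f^n_u(\mathbf{X}_u)\tilde f^n_{u^c}(\mathbf{X})\big),$$ and $$\phi(u_1,u_2,u_3,u_4,u_5,u_6) = \frac{u_4-u_1^2+u_6-u_1u_2}{u_5-u_3^2}.$$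
   Context: Let $p,n\ge 1$. $S$ is the collection of all nonempty subsets of $\{1,\dots,p\}$; for $u\in S$ and $\mathbf{x}\in\mathbb{R}^p$, $\mathbf{x}_u=(x_i)_{i\in u}$ (similarly $\mathbf{X}_u$, $\mathbf{t}^j_u$). The random vector $\mathbf{X}=(X_1,\dots,X_p)$ has distribution $P_{\mathbf{X}}$ with a density with respect to Lebesgue measure on $\mathbb{R}^p$ (its components may be dependent), and $p_{X_i}$ denotes the marginal density of $X_i$. $\mathbb{E}$, $V$, $\mathrm{Cov}$ denote expectation, variance and covariance with respect to $P_{\mathbf{X}}$ only. For each $i=1,\dots,p$, $\tilde k^i:\mathbb{R}\times\mathbb{R}\to\mathbb{R}$ is a given measurable covariance kernel such that $\tilde k^i(w,\cdot)$ is integrable with respect to $p_{X_i}(\tilde w)d\tilde w$ for every $w$, $\tilde k^i$ is integrable with respect to $p_{X_i}(w)p_{X_i}(\tilde w)\,dw\,d\tilde w$, and the latter integral is nonzero. Set $$k_0^i(x,\tilde x) = \tilde k^i(x,\tilde x) - \frac{\int \tilde k^i(x,w)p_{X_i}(w)dw\,\int \tilde k^i(\tilde w,\tilde x)p_{X_i}(\tilde w)d\tilde w}{\int\!\!\int \tilde k^i(w,\tilde w)p_{X_i}(w)p_{X_i}(\tilde w)\,dw\,d\tilde w},\qquad k(\mathbf{x},\tilde{\mathbf{x}}) = \sigma^2\prod_{i=1}^p\big(1+k_0^i(x_i,\tilde x_i)\big),$$ with $\sigma^2>0$ and $\sup k<\infty$. On a probability space $(\Omega_Z,\mathcal{A}_Z,\mathbb{P}_Z)$,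 let $Z_0\sim\mathcal{N}(0,\sigma^2)$ and, for $u\in S$, let $Z_u$ be a centered Gaussian process indexed by $\mathbf{x}_u$ with covariance kernel $\sigma^2\prod_{i\in u}k_0^i(x_i,\tilde x_i)$, all mutually independent and jointly measurable in $(\omega,\mathbf{x})$; let $Z(\mathbf{x})=Z_0+\sum_{u\in S}Z_u(\mathbf{x}_u)$. Fix design points $\mathbf{x}^1,\dots,\mathbf{x}^n\in\mathbb{R}^p$, a vector $\mathbf{z}_n\in\mathbb{R}^n$ of observed outputs and a constant $f_0\in\mathbb{R}$. Let $\mathbf{1}_n$ be the all-ones vector, $\mathbf{K}_n=[k(\mathbf{x}^j,\mathbf{x}^l)]_{j,l=1,\dots,n}$ (assumed invertible), $\mathbf{k}^i_{0,n}(x_i)=(k_0^i(x_i,x_i^j))_{j=1,\dots,n}$, $\mathbf{Z}_n={}^t(Z(\mathbf{x}^1),\dots,Z(\mathbf{x}^n))$, and let $\bigodot$ denote the entrywise product. Define $$f^n_0 = f_0+\sigma^2\,{}^t\mathbf{1}_n\mathbf{K}_n^{-1}(\mathbf{z}_n-f_0\mathbf{1}_n-\mathbf{Z}_n)+Z_0,$$ $$f^n_u(\mathbf{x}_u)=\sigma^2\,{}^t\Big(\bigodot_{i\in u}\mathbf{k}^i_{0,n}(x_i)\Big)\mathbf{K}_n^{-1}(\mathbf{z}_n-f_0\mathbf{1}_n-\mathbf{Z}_n)+Z_u(\mathbf{x}_u)\quad(u\in S),$$ $$f^n(\mathbf{x})=f^n_0+\sum_{u\in S}f^n_u(\mathbf{x}_u),\qquad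 f^n_{u^c}(\mathbf{x})=f^n(\mathbf{x})-f^n_u(\mathbf{x}_u).$$ A tilde denotes the realization for a fixed $\omega\in\Omega_Z$, the same $\omega$ for all of these processes; thus $\tilde f^n_v$ ($v\in S$), $\tilde f^n$, $\tilde f^n_{u^c}$ are deterministic measurable functions, $\tilde f^n=\tilde f^n_0+\sum_{v\in S}\tilde f^n_v$ with $\tilde f^n_0$ a real constant, and $\tilde f^n=\tilde f^n_u+\tilde f^n_{u^c}$. The only randomness in the convergence statement is that of the sample $(\mathbf{t}^j)$. $\xrightarrow{\mathcal{L}}$ denotes convergence in distribution; $\mathcal{N}(0,0)$ is the Dirac mass at $0$; $s^f_{u,m}$ may be given any value (e.g. $0$) when its denominator vanishes; $\nabla\phi$ is the gradient (column vector) and ${}^t$ denotes transpose. *)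

theory Defs
  imports "HOL-Probability.Probability"
begin

definition covar :: "'a measure \<Rightarrow> ('a \<Rightarrow> real) \<Rightarrow> ('a \<Rightarrow> real) \<Rightarrow> real" where
  "covar M X Y = prob_space.expectation M
     (\<lambda>w. (X w - prob_space.expectation M X) * (Y w - prob_space.expectation M Y))"

definition cov_matrix :: "'a measure \<Rightarrow> ('a \<Rightarrow> real^'d) \<Rightarrow> real^'d^'d" where
  "cov_matrix M U = (\<chi> i j. covar M (\<lambda>w. U w $ i) (\<lambda>w. U w $ j))"

text \<open>The normal law with mean \<open>m\<close> and variance \<open>v \<ge> 0\<close>, the Dirac mass at \<open>m\<close> if \<open>v = 0\<close>.
  The second parameter of \<open>normal_density\<close> is the standard deviation.\<close>

definition gaussian :: "real \<Rightarrow> real \<Rightarrow> real measure" where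
  "gaussian m v =
     (if v = 0 then return borel m else density lborel (\<lambda>x. ennreal (normal_density m (sqrt v) x)))"

definition covariance_kernel :: "('t \<Rightarrow> 't \<Rightarrow> real) \<Rightarrow> bool" where
  "covariance_kernel K \<longleftrightarrow>
     (\<forall>x y. K x y = K y x) \<and>
     (\<forall>F c. finite F \<longrightarrow> 0 \<le> (\<Sum>x\<in>F. \<Sum>y\<in>F. c x * c y * K x y))"

text \<open>A process is Gaussian if all finite linear combinations of its values are normal,
  possibly degenerate.\<close>

definition centered_gaussian_process ::
    "'w measure \<Rightarrow> 't set \<Rightarrow> ('t \<Rightarrow> 'w \<Rightarrow> real) \<Rightarrow> ('t \<Rightarrow> 't \<Rightarrow> real) \<Rightarrow> bool" where
  "centered_gaussian_process M T Y K \<longleftrightarrow>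
     (\<forall>t\<in>T. Y t \<in> borel_measurable M) \<and>
     (\<forall>F c. finite F \<and> F \<subseteq> T \<longrightarrow>
        (\<exists>m v. 0 \<le> v \<and> distr M borel (\<lambda>w. \<Sum>t\<in>F. c t * Y t w) = gaussian m v)) \<and>
     (\<forall>t\<in>T. prob_space.expectation M (Y t) = 0) \<and>
     (\<forall>s\<in>T. \<forall>t\<in>T. covar M (Y s) (Y t) = K s t)"

definition gradient :: "('a::real_inner \<Rightarrow> real) \<Rightarrow> 'a \<Rightarrow> 'a" where
  "gradient f x = (THE D. GDERIV f x :> D)"

text \<open>The space of vectors indexed by \<open>u\<close>, i.e. the carrier of
  \<open>PiM u (\<lambda>_. borel)\<close>, and the subvector of \<open>x\<close> with indices in \<open>u\<close>.\<close>

abbreviation vecs :: "'p set \<Rightarrow> ('p \<Rightarrow> real) set" where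
  "vecs u \<equiv> Pi\<^sub>E u (\<lambda>_. UNIV)"

definition subvec :: "'p set \<Rightarrow> real^'p \<Rightarrow> 'p \<Rightarrow> real" where
  "subvec u x = (\<lambda>i\<in>u. x $ i)"

definition centered_kernel ::
    "(real \<Rightarrow> real) \<Rightarrow> (real \<Rightarrow> real \<Rightarrow> real) \<Rightarrow> real \<Rightarrow> real \<Rightarrow> real" where
  "centered_kernel d \<kappa> x x' =
     \<kappa> x x' - (LINT w|lborel. \<kappa> x w * d w) * (LINT w|lborel. \<kappa> w x' * d w) /
       (LINT (w, w')|(lborel \<Otimes>\<^sub>M lborel). \<kappa> w w' * d w * d w')"

definition anova_kernel ::
    "real \<Rightarrow> ('p \<Rightarrow> real \<Rightarrow> real \<Rightarrow> real) \<Rightarrow> real^'p \<Rightarrow> real^'p \<Rightarrow> real" where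
  "anova_kernel \<sigma> k0 x x' = \<sigma>\<^sup>2 * (\<Prod>i\<in>UNIV. 1 + k0 i (x $ i) (x' $ i))"

definition component_kernel ::
    "real \<Rightarrow> ('p \<Rightarrow> real \<Rightarrow> real \<Rightarrow> real) \<Rightarrow> 'p set \<Rightarrow> ('p \<Rightarrow> real) \<Rightarrow> ('p \<Rightarrow> real) \<Rightarrow> real" where
  "component_kernel \<sigma> k0 u y y' = \<sigma>\<^sup>2 * (\<Prod>i\<in>u. k0 i (y i) (y' i))"

definition gram_matrix :: "('a \<Rightarrow> 'a \<Rightarrow> real) \<Rightarrow> 'a^'n \<Rightarrow> real^'n^'n" where
  "gram_matrix k D = (\<chi> j l. k (D $ j) (D $ l))"

definition total_process ::
    "('w \<Rightarrow> real) \<Rightarrow> ('p set \<Rightarrow> ('p \<Rightarrow> real) \<Rightarrow> 'w \<Rightarrow> real) \<Rightarrow> real^'p \<Rightarrow> 'w \<Rightarrow> real" where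
  "total_process Z0 Z x \<omega> = Z0 \<omega> + (\<Sum>u | u \<noteq> {}. Z u (subvec u x) \<omega>)"

text \<open>In the following, \<open>D\<close> are the design points, \<open>z\<close> the observed outputs and \<open>f0\<close> the prior mean;
  \<open>1 :: real^'n\<close> is the all-ones vector.\<close>

definition residual_weights ::
    "real \<Rightarrow> ('p \<Rightarrow> real \<Rightarrow> real \<Rightarrow> real) \<Rightarrow> (real^'p)^'n \<Rightarrow> real^'n \<Rightarrow> real \<Rightarrow>
     ('w \<Rightarrow> real) \<Rightarrow> ('p set \<Rightarrow> ('p \<Rightarrow> real) \<Rightarrow> 'w \<Rightarrow> real) \<Rightarrow> 'w \<Rightarrow> real^'n" where
  "residual_weights \<sigma> k0 D z f0 Z0 Z \<omega> =
     matrix_inv (gram_matrix (anova_kernel \<sigma> k0) D) *v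
       (z - f0 *\<^sub>R 1 - (\<chi> j. total_process Z0 Z (D $ j) \<omega>))"

definition posterior_const ::
    "real \<Rightarrow> ('p \<Rightarrow> real \<Rightarrow> real \<Rightarrow> real) \<Rightarrow> (real^'p)^'n \<Rightarrow> real^'n \<Rightarrow> real \<Rightarrow>
     ('w \<Rightarrow> real) \<Rightarrow> ('p set \<Rightarrow> ('p \<Rightarrow> real) \<Rightarrow> 'w \<Rightarrow> real) \<Rightarrow> 'w \<Rightarrow> real" where
  "posterior_const \<sigma> k0 D z f0 Z0 Z \<omega> =
     f0 + \<sigma>\<^sup>2 * (1 \<bullet> residual_weights \<sigma> k0 D z f0 Z0 Z \<omega>) + Z0 \<omega>"

definition posterior_component ::
    "real \<Rightarrow> ('p \<Rightarrow> real \<Rightarrow> real \<Rightarrow> real) \<Rightarrow> (real^'p)^'n \<Rightarrow> real^'n \<Rightarrow> real \<Rightarrow>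
     ('w \<Rightarrow> real) \<Rightarrow> ('p set \<Rightarrow> ('p \<Rightarrow> real) \<Rightarrow> 'w \<Rightarrow> real) \<Rightarrow> 'p set \<Rightarrow> ('p \<Rightarrow> real) \<Rightarrow> 'w \<Rightarrow> real" where
  "posterior_component \<sigma> k0 D z f0 Z0 Z u y \<omega> =
     \<sigma>\<^sup>2 * ((\<chi> j. \<Prod>i\<in>u. k0 i (y i) (D $ j $ i)) \<bullet> residual_weights \<sigma> k0 D z f0 Z0 Z \<omega>) + Z u y \<omega>"

definition posterior ::
    "real \<Rightarrow> ('p \<Rightarrow> real \<Rightarrow> real \<Rightarrow> real) \<Rightarrow> (real^'p)^'n \<Rightarrow> real^'n \<Rightarrow> real \<Rightarrow>
     ('w \<Rightarrow> real) \<Rightarrow> ('p set \<Rightarrow> ('p \<Rightarrow> real) \<Rightarrow> 'w \<Rightarrow> real) \<Rightarrow> real^'p \<Rightarrow> 'w \<Rightarrow> real" where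
  "posterior \<sigma> k0 D z f0 Z0 Z x \<omega> =
     posterior_const \<sigma> k0 D z f0 Z0 Z \<omega> +
     (\<Sum>u | u \<noteq> {}. posterior_component \<sigma> k0 D z f0 Z0 Z u (subvec u x) \<omega>)"

text \<open>Here \<open>g\<close>, \<open>h\<close> and \<open>f\<close> stand for a component of the model, its complement and the full model,
  all as functions of the full input vector.\<close>

definition sensitivity ::
    "'a measure \<Rightarrow> ('a \<Rightarrow> 'b) \<Rightarrow> ('b \<Rightarrow> real) \<Rightarrow> ('b \<Rightarrow> real) \<Rightarrow> ('b \<Rightarrow> real) \<Rightarrow> real" where
  "sensitivity M X g h f =
     (prob_space.variance M (\<lambda>w. g (X w)) + covar M (\<lambda>w. g (X w)) (\<lambda>w. h (X w))) /
     prob_space.variance M (\<lambda>w. f (X w))"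

text \<open>The sample of size \<open>m\<close> is indexed by \<open>0, \<dots>, m - 1\<close>.\<close>

definition sample_mean :: "nat \<Rightarrow> (nat \<Rightarrow> 'b) \<Rightarrow> ('b \<Rightarrow> real) \<Rightarrow> real" where
  "sample_mean m t g = (1 / real m) * (\<Sum>j<m. g (t j))"

definition sensitivity_estimator ::
    "nat \<Rightarrow> (nat \<Rightarrow> 'b) \<Rightarrow> ('b \<Rightarrow> real) \<Rightarrow> ('b \<Rightarrow> real) \<Rightarrow> ('b \<Rightarrow> real) \<Rightarrow> real" where
  "sensitivity_estimator m t g h f =
     (sample_mean m t (\<lambda>x. (g x)\<^sup>2) - (sample_mean m t g)\<^sup>2
       + sample_mean m t (\<lambda>x. g x * h x) - sample_mean m t g * sample_mean m t h) /
     (sample_mean m t (\<lambda>x. (f x)\<^sup>2) - (sample_mean m t f)\<^sup>2)"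

definition phi :: "real^6 \<Rightarrow> real" where
  "phi u = (u $ 4 - (u $ 1)\<^sup>2 + u $ 6 - u $ 1 * u $ 2) / (u $ 5 - (u $ 3)\<^sup>2)"

end

theory Submission
  imports Defs
begin

text \<open>With \<open>G\<close>, \<open>H\<close>, \<open>F\<close> the centred component, complement and full model and \<open>s\<close> the sensitivity
  measure, the estimator is a quotient \<open>A / B\<close> with \<open>B\<close> tending to the variance \<open>V\<close> of the model in probability.
  Up to products of two centred sample means, \<open>A - s * B\<close> is the sample mean of
  \<open>G\<^sup>2 + G * H - s * F\<^sup>2\<close>; such products are of order \<open>1 / m\<close> in mean, so after scaling by
  \<open>sqrt m\<close> they vanish in probability. Hence the scaled error is asymptotically the scaled sample mean of
  \<open>(G\<^sup>2 + G * H - s * F\<^sup>2) / V\<close>, to which the central limit theorem applies, and that function,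
  evaluated at \<open>X\<close>, is \<open>\<nabla>\<phi>(\<mu>) \<bullet> (U - \<mu>)\<close>.\<close>

subsection \<open>Convergence to zero in probability\<close>

context prob_space
begin

definition in_prob_zero :: "(nat \<Rightarrow> 'a \<Rightarrow> real) \<Rightarrow> bool" where
  "in_prob_zero R \<longleftrightarrow> (\<forall>e>0. (\<lambda>m. prob {w \<in> space M. e \<le> \<bar>R m w\<bar>}) \<longlonglongrightarrow> 0)"

text \<open>The event \<open>e \<le> \<bar>R m w\<bar>\<close> lies in the union of the events where
  \<open>\<bar>X m w\<bar>\<close> or \<open>\<bar>Y m w\<bar>\<close> is at least \<open>d\<close>,
  so a union bound suffices. The closure properties below thereby become deterministic epsilon-delta
  estimates; asking for them only eventually leaves room for identities that fail at
  \<open>m = 0\<close>.\<close>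

lemma in_prob_zero_dominated:
  assumes X: "in_prob_zero X" and Y: "in_prob_zero Y"
    and [measurable]: "\<And>m. random_variable borel (X m)" "\<And>m. random_variable borel (Y m)"
    and R: "\<And>e. e > 0 \<Longrightarrow> \<exists>d>0. \<forall>\<^sub>F m in sequentially. \<forall>w\<in>space M.
      \<bar>X m w\<bar> < d \<longrightarrow> \<bar>Y m w\<bar> < d \<longrightarrow> \<bar>R m w\<bar> < e"
  shows "in_prob_zero R"
  unfolding in_prob_zero_def
proof (intro allI impI)
  fix e :: real assume "e > 0"
  from R[OF this] obtain d where d: "d > 0" and ev: "\<forall>\<^sub>F m in sequentially. \<forall>w\<in>space M.
      \<bar>X m w\<bar> < d \<longrightarrow> \<bar>Y m w\<bar> < d \<longrightarrow> \<bar>R m w\<bar> < e" by blast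
  let ?p = "\<lambda>Z m. prob {w \<in> space M. d \<le> \<bar>Z m w\<bar>}"
  have lim: "(\<lambda>m. ?p X m + ?p Y m) \<longlonglongrightarrow> 0"
    using X Y d unfolding in_prob_zero_def by (intro tendsto_add_zero) blast+
  have le: "\<forall>\<^sub>F m in sequentially. prob {w \<in> space M. e \<le> \<bar>R m w\<bar>} \<le> ?p X m + ?p Y m"
    using ev
  proof eventually_elim
    case (elim m)
    have "prob {w \<in> space M. e \<le> \<bar>R m w\<bar>}
        \<le> prob ({w \<in> space M. d \<le> \<bar>X m w\<bar>} \<union> {w \<in> space M. d \<le> \<bar>Y m w\<bar>})"
      using elim by (intro finite_measure_mono) (auto simp: not_le[symmetric])
    also have "\<dots> \<le> ?p X m + ?p Y m"
      by (intro measure_Un_le) auto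
    finally show ?case .
  qed
  show "(\<lambda>m. prob {w \<in> space M. e \<le> \<bar>R m w\<bar>}) \<longlonglongrightarrow> 0"
    by (rule tendsto_sandwich[OF _ le tendsto_const lim]) simp
qed

lemma in_prob_zero_add:
  assumes "in_prob_zero X" "in_prob_zero Y"
    and "\<And>m. random_variable borel (X m)" "\<And>m. random_variable borel (Y m)"
  shows "in_prob_zero (\<lambda>m w. X m w + Y m w)"
proof (rule in_prob_zero_dominated[OF assms])
  fix e :: real assume "e > 0"
  then show "\<exists>d>0. \<forall>\<^sub>F m in sequentially. \<forall>w\<in>space M.
      \<bar>X m w\<bar> < d \<longrightarrow> \<bar>Y m w\<bar> < d \<longrightarrow> \<bar>X m w + Y m w\<bar> < e"
    by (intro exI[of _ "e / 2"]) (auto intro!: always_eventually)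
qed

lemma in_prob_zero_mult:
  assumes "in_prob_zero X" "in_prob_zero Y"
    and "\<And>m. random_variable borel (X m)" "\<And>m. random_variable borel (Y m)"
  shows "in_prob_zero (\<lambda>m w. X m w * Y m w)"
proof (rule in_prob_zero_dominated[OF assms])
  fix e :: real assume e: "e > 0"
  \<comment> \<open>One factor is kept below \<open>e\<close> and the other below \<open>1\<close>,
    whatever the size of \<open>e\<close>.\<close>
  have "\<bar>x * y\<bar> < e" if "\<bar>x\<bar> < min e 1" "\<bar>y\<bar> < min e 1" for x y
    using mult_strict_mono'[of "\<bar>x\<bar>" e "\<bar>y\<bar>" 1] that e by (simp add: abs_mult)
  then show "\<exists>d>0. \<forall>\<^sub>F m in sequentially. \<forall>w\<in>space M.
      \<bar>X m w\<bar> < d \<longrightarrow> \<bar>Y m w\<bar> < d \<longrightarrow> \<bar>X m w * Y m w\<bar> < e"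
    using e by (intro exI[of _ "min e 1"] conjI always_eventually) auto
qed

lemma in_prob_zero_cmult:
  assumes "in_prob_zero X" "\<And>m. random_variable borel (X m)"
  shows "in_prob_zero (\<lambda>m w. c * X m w)"
proof (rule in_prob_zero_dominated[OF assms(1,1,2,2)])
  fix e :: real assume e: "e > 0"
  \<comment> \<open>The summand \<open>1\<close> keeps the threshold positive when
    \<open>c = 0\<close>.\<close>
  have "\<bar>c * x\<bar> < e" if "\<bar>x\<bar> < e / (\<bar>c\<bar> + 1)" for x
  proof -
    have "\<bar>c * x\<bar> \<le> (\<bar>c\<bar> + 1) * \<bar>x\<bar>" by (simp add: abs_mult mult_right_mono)
    also have "\<dots> < e" using that by (simp add: pos_less_divide_eq mult.commute)
    finally show ?thesis .
  qed
  then show "\<exists>d>0. \<forall>\<^sub>F m in sequentially. \<forall>w\<in>space M.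
      \<bar>X m w\<bar> < d \<longrightarrow> \<bar>X m w\<bar> < d \<longrightarrow> \<bar>c * X m w\<bar> < e"
    using e by (intro exI[of _ "e / (\<bar>c\<bar> + 1)"] conjI always_eventually) auto
qed

text \<open>Near its nonzero limit \<open>b\<close> the denominator stays away from
  \<open>0\<close>. Prescribing \<open>R\<close> only where \<open>B m w \<noteq> 0\<close> makes
  the value of a quotient with vanishing denominator irrelevant.\<close>

lemma in_prob_zero_divide:
  assumes "in_prob_zero X" "in_prob_zero (\<lambda>m w. B m w - b)" and b: "b \<noteq> 0"
    and "\<And>m. random_variable borel (X m)" and [measurable]: "\<And>m. random_variable borel (B m)"
    and R: "\<forall>\<^sub>F m in sequentially. \<forall>w\<in>space M. B m w \<noteq> 0 \<longrightarrow> R m w = X m w / B m w"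
  shows "in_prob_zero R"
proof (rule in_prob_zero_dominated[OF assms(1,2,4)])
  show "random_variable borel (\<lambda>w. B m w - b)" for m by measurable
  fix e :: real assume e: "e > 0"
  \<comment> \<open>The first bound forces \<open>\<bar>B m w\<bar> > \<bar>b\<bar> / 2\<close>; the
    second then makes the quotient smaller than \<open>e\<close>.\<close>
  define d where "d = min (\<bar>b\<bar> / 2) (e * \<bar>b\<bar> / 2)"
  have d: "d > 0" using e b by (simp add: d_def)
  have *: "y \<noteq> 0 \<and> \<bar>x / y\<bar> < e" if "\<bar>x\<bar> < d" "\<bar>y - b\<bar> < d" for x y
  proof -
    have "\<bar>y - b\<bar> < \<bar>b\<bar> / 2" using that(2) by (simp add: d_def)
    then have y: "\<bar>y\<bar> > \<bar>b\<bar> / 2" by linarith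
    have "\<bar>x\<bar> < e * (\<bar>b\<bar> / 2)" using that(1) by (simp add: d_def)
    also have "\<dots> < e * \<bar>y\<bar>" using y e by (intro mult_strict_left_mono) auto
    finally show ?thesis using y by (auto simp: abs_divide pos_divide_less_eq)
  qed
  show "\<exists>d>0. \<forall>\<^sub>F m in sequentially. \<forall>w\<in>space M.
      \<bar>X m w\<bar> < d \<longrightarrow> \<bar>B m w - b\<bar> < d \<longrightarrow> \<bar>R m w\<bar> < e"
  proof (intro exI[of _ d] conjI d)
    show "\<forall>\<^sub>F m in sequentially. \<forall>w\<in>space M.
      \<bar>X m w\<bar> < d \<longrightarrow> \<bar>B m w - b\<bar> < d \<longrightarrow> \<bar>R m w\<bar> < e"
      using R by eventually_elim (use * in simp)
  qed
qed

lemma in_prob_zero_L1: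
  assumes I: "\<And>m. integrable M (X m)" and L: "(\<lambda>m. expectation (\<lambda>w. \<bar>X m w\<bar>)) \<longlonglongrightarrow> 0"
  shows "in_prob_zero X"
  unfolding in_prob_zero_def
proof (intro allI impI)
  fix e :: real assume e: "e > 0"
  have lim: "(\<lambda>m. expectation (\<lambda>w. \<bar>X m w\<bar>) / e) \<longlonglongrightarrow> 0"
    using tendsto_divide[OF L tendsto_const, of e] e by simp
  have le: "prob {w \<in> space M. e \<le> \<bar>X m w\<bar>} \<le> expectation (\<lambda>w. \<bar>X m w\<bar>) / e" for m
    by (rule integral_Markov_inequality_measure[where A = "{}"]) (use I e in auto)
  show "(\<lambda>m. prob {w \<in> space M. e \<le> \<bar>X m w\<bar>}) \<longlonglongrightarrow> 0"
    by (rule tendsto_sandwich[OF _ always_eventually tendsto_const lim]) (simp_all add: le)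
qed

text \<open>The modulus of \<open>iexp (s * (x + r)) - iexp (s * x)\<close> is that of
  \<open>iexp (s * r) - 1\<close>, which is at most \<open>\<bar>s\<bar> * d\<close> where
  \<open>\<bar>r\<bar> < d\<close> and at most \<open>2\<close> on the remaining event of small
  probability.\<close>

lemma in_prob_zero_char_diff:
  assumes R: "in_prob_zero R"
    and [measurable]: "\<And>m. random_variable borel (R m)" "\<And>m. random_variable borel (X m)"
  shows "(\<lambda>m. char (distr M borel (\<lambda>w. X m w + R m w)) s - char (distr M borel (X m)) s) \<longlonglongrightarrow> 0"
proof (rule LIMSEQ_I)
  fix e :: real assume e: "e > 0"
  \<comment> \<open>Half of \<open>e\<close> is spent on \<open>\<bar>s\<bar> * d\<close>, the other
    half on twice a probability below \<open>e / 4\<close>; the summand \<open>1\<close> covers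
    \<open>s = 0\<close>.\<close>
  define d where "d = e / (2 * (\<bar>s\<bar> + 1))"
  have d: "d > 0" using e by (simp add: d_def)
  have sd: "\<bar>s\<bar> * d < e / 2"
  proof -
    have "\<bar>s\<bar> * d < (\<bar>s\<bar> + 1) * d" using d by (simp add: mult_strict_right_mono)
    also have "\<dots> = e / 2" by (simp add: d_def field_simps)
    finally show ?thesis .
  qed
  let ?A = "\<lambda>m. {w \<in> space M. d \<le> \<bar>R m w\<bar>}"
  have bound: "norm (char (distr M borel (\<lambda>w. X m w + R m w)) s - char (distr M borel (X m)) s)
      \<le> \<bar>s\<bar> * d + 2 * prob (?A m)" for m
  proof -
    have int: "integrable M (\<lambda>w. iexp (s * X m w))" "integrable M (\<lambda>w. iexp (s * (X m w + R m w)))"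
      using integrable_iexp[of "\<lambda>w. complex_of_real (s * X m w)"]
        integrable_iexp[of "\<lambda>w. complex_of_real (s * (X m w + R m w))"] by simp_all
    have "char (distr M borel (\<lambda>w. X m w + R m w)) s - char (distr M borel (X m)) s
        = (CLINT w|M. iexp (s * (X m w + R m w)) - iexp (s * X m w))"
      unfolding char_def using int by (simp add: integral_distr)
    also have "norm \<dots> \<le> expectation (\<lambda>w. norm (iexp (s * (X m w + R m w)) - iexp (s * X m w)))"
      by (rule integral_norm_bound)
    also have "\<dots> \<le> expectation (\<lambda>w. \<bar>s\<bar> * d + 2 * indicator (?A m) w)"
    proof (rule integral_mono)
      show "integrable M (\<lambda>w. norm (iexp (s * (X m w + R m w)) - iexp (s * X m w)))"
        using int by auto
      show "integrable M (\<lambda>w. \<bar>s\<bar> * d + 2 * indicator (?A m) w)"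
        by (intro Bochner_Integration.integrable_add integrable_const integrable_mult_right)
          (auto simp: integrable_indicator_iff less_top[symmetric])
      fix w assume w: "w \<in> space M"
      have "iexp (s * (X m w + R m w)) - iexp (s * X m w)
          = iexp (s * X m w) * (iexp (s * R m w) - 1)"
        by (simp add: algebra_simps exp_add)
      then have eq: "norm (iexp (s * (X m w + R m w)) - iexp (s * X m w)) = norm (iexp (s * R m w) - 1)"
        by (simp add: norm_mult del: of_real_mult)
      show "norm (iexp (s * (X m w + R m w)) - iexp (s * X m w)) \<le> \<bar>s\<bar> * d + 2 * indicator (?A m) w"
      proof (cases "d \<le> \<bar>R m w\<bar>")
        case True
        have "norm (iexp (s * R m w) - 1) \<le> norm (iexp (s * R m w)) + norm (1::complex)"
          by (rule norm_triangle_ineq4)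
        then have "norm (iexp (s * R m w) - 1) \<le> 2" by (simp del: of_real_mult)
        moreover have "0 \<le> \<bar>s\<bar> * d" using d by simp
        ultimately show ?thesis unfolding eq using True w by simp
      next
        case False
        have "norm (iexp (s * R m w) - 1) \<le> \<bar>s * R m w\<bar>"
          using iexp_approx1[of "s * R m w" 0] by simp
        also have "\<dots> \<le> \<bar>s\<bar> * d" using False by (simp add: abs_mult mult_left_mono)
        finally show ?thesis unfolding eq using False by simp
      qed
    qed
    also have "\<dots> = \<bar>s\<bar> * d + 2 * prob (?A m)"
      by (subst Bochner_Integration.integral_add)
        (auto simp: prob_space integrable_indicator_iff less_top[symmetric])
    finally show ?thesis .
  qed
  have "(\<lambda>m. prob (?A m)) \<longlonglongrightarrow> 0" using R d unfolding in_prob_zero_def by blast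
  then have "\<forall>\<^sub>F m in sequentially. prob (?A m) < e / 4"
    using e by (intro order_tendstoD) auto
  then obtain m0 where m0: "\<And>m. m \<ge> m0 \<Longrightarrow> prob (?A m) < e / 4"
    by (auto simp: eventually_sequentially)
  show "\<exists>m0. \<forall>m\<ge>m0. norm (char (distr M borel (\<lambda>w. X m w + R m w)) s
      - char (distr M borel (X m)) s - 0) < e"
  proof (intro exI[of _ m0] allI impI)
    fix m assume "m \<ge> m0"
    from m0[OF this] bound[of m] sd
    show "norm (char (distr M borel (\<lambda>w. X m w + R m w)) s - char (distr M borel (X m)) s - 0) < e"
      by simp
  qed
qed

text \<open>By Levy continuity convergence can be read off from characteristic functions, and the
  perturbation changes these by a null sequence.\<close>

theorem slutsky_add:
  assumes L: "real_distribution L" and X: "weak_conv_m (\<lambda>m. distr M borel (X m)) L"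
    and R: "in_prob_zero R"
    and [measurable]: "\<And>m. random_variable borel (R m)" "\<And>m. random_variable borel (X m)"
  shows "weak_conv_m (\<lambda>m. distr M borel (\<lambda>w. X m w + R m w)) L"
proof (rule levy_continuity[OF _ L])
  show "real_distribution (distr M borel (\<lambda>w. X m w + R m w))" for m by simp
  fix s
  have "(\<lambda>m. char (distr M borel (X m)) s) \<longlonglongrightarrow> char L s"
    by (rule levy_continuity1[OF _ L X]) simp
  from tendsto_add[OF in_prob_zero_char_diff[OF R, of X s] this]
  show "(\<lambda>m. char (distr M borel (\<lambda>w. X m w + R m w)) s) \<longlonglongrightarrow> char L s" by simp
qed

end

section \<open>Normal limit laws and their scaling\<close>

lemma real_distribution_gaussian: "v \<ge> 0 \<Longrightarrow> real_distribution (gaussian m v)"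
  unfolding gaussian_def real_distribution_def real_distribution_axioms_def
  by (auto intro!: prob_space_normal_density prob_space_return)

text \<open>An affine image of a normal density is normal. The image form gives access to the
  characteristic function by substitution; \<open>c > 0\<close> selects the density branch of
  \<open>gaussian\<close>.\<close>

lemma gaussian_eq_distr_std_normal:
  assumes "c > 0"
  shows "gaussian 0 (c\<^sup>2) = distr std_normal_distribution borel (\<lambda>x. c * x)"
proof -
  interpret N: prob_space std_normal_distribution by (rule prob_space_normal_density) simp
  have "distributed std_normal_distribution lborel (\<lambda>x. x) (\<lambda>x. ennreal (std_normal_density x))"
    by (auto simp: distributed_def distr_id2 cong: distr_cong)
  from N.normal_density_affine[OF this, of c 0] assms
  have "distributed std_normal_distribution lborel (\<lambda>x. c * x) (\<lambda>x. ennreal (normal_density 0 c x))"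
    by simp
  then have "distr std_normal_distribution lborel (\<lambda>x. c * x) = density lborel (\<lambda>x. ennreal (normal_density 0 c x))"
    by (rule distributed_distr_eq_density)
  moreover have "distr std_normal_distribution lborel (\<lambda>x. c * x) = distr std_normal_distribution borel (\<lambda>x. c * x)"
    by (rule distr_cong) auto
  ultimately show ?thesis using assms by (simp add: gaussian_def)
qed

text \<open>Scaling by \<open>c\<close> moves the argument of a characteristic function from
  \<open>s\<close> to \<open>s * c\<close>, for the sequence and for the limit alike.\<close>

lemma (in prob_space) weak_conv_scale_std_normal:
  assumes X: "weak_conv_m (\<lambda>m. distr M borel (X m)) std_normal_distribution" and c: "c > 0"
    and [measurable]: "\<And>m. random_variable borel (X m)"
  shows "weak_conv_m (\<lambda>m. distr M borel (\<lambda>w. c * X m w)) (gaussian 0 (c\<^sup>2))"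
proof (rule levy_continuity)
  show "real_distribution (distr M borel (\<lambda>w. c * X m w))" for m by simp
  show "real_distribution (gaussian 0 (c\<^sup>2))" by (rule real_distribution_gaussian) simp
  fix s
  have "char (distr M borel (\<lambda>w. c * X m w)) s = char (distr M borel (X m)) (s * c)" for m
    by (simp add: char_def integral_distr mult.assoc)
  moreover have "char (gaussian 0 (c\<^sup>2)) s = char std_normal_distribution (s * c)"
    unfolding gaussian_eq_distr_std_normal[OF c] by (simp add: char_def integral_distr mult.assoc)
  moreover have "(\<lambda>m. char (distr M borel (X m)) (s * c)) \<longlonglongrightarrow> char std_normal_distribution (s * c)"
    by (rule levy_continuity1[OF _ real_dist_normal_dist X]) simp
  ultimately show "(\<lambda>m. char (distr M borel (\<lambda>w. c * X m w)) s) \<longlonglongrightarrow> char (gaussian 0 (c\<^sup>2)) s"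
    by simp
qed

subsection \<open>Sample means of independent identically distributed variables\<close>

lemma integrable_mult_of_squares:
  fixes f g :: "'a \<Rightarrow> real"
  assumes [measurable]: "f \<in> borel_measurable M" "g \<in> borel_measurable M"
    and "integrable M (\<lambda>x. (f x)\<^sup>2)" "integrable M (\<lambda>x. (g x)\<^sup>2)"
  shows "integrable M (\<lambda>x. f x * g x)"
proof (rule Bochner_Integration.integrable_bound)
  show "integrable M (\<lambda>x. (f x)\<^sup>2 + (g x)\<^sup>2)" using assms(3,4) by simp
  have "\<bar>a * b\<bar> \<le> a\<^sup>2 + b\<^sup>2" for a b :: real
    using zero_le_power2[of "\<bar>a\<bar> - \<bar>b\<bar>"] mult_nonneg_nonneg[of "\<bar>a\<bar>" "\<bar>b\<bar>"]
    unfolding power2_diff abs_mult power2_abs by linarith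
  then show "AE x in M. norm (f x * g x) \<le> norm ((f x)\<^sup>2 + (g x)\<^sup>2)" by simp
qed measurable

text \<open>Measurability is bundled in, so that the closure properties can be chained as
  introduction rules.\<close>

definition square_integrable :: "'a measure \<Rightarrow> ('a \<Rightarrow> real) \<Rightarrow> bool" where
  "square_integrable M f \<longleftrightarrow> f \<in> borel_measurable M \<and> integrable M (\<lambda>x. (f x)\<^sup>2)"

lemma square_integrable_measurable: "square_integrable M f \<Longrightarrow> f \<in> borel_measurable M"
  and square_integrable_square: "square_integrable M f \<Longrightarrow> integrable M (\<lambda>x. (f x)\<^sup>2)"
  by (simp_all add: square_integrable_def)

lemma square_integrable_mult:
  "square_integrable M f \<Longrightarrow> square_integrable M g \<Longrightarrow> integrable M (\<lambda>x. f x * g x)"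
  by (simp add: square_integrable_def integrable_mult_of_squares)

lemma square_integrable_cmult: "square_integrable M f \<Longrightarrow> square_integrable M (\<lambda>x. c * f x)"
  by (auto simp: square_integrable_def power_mult_distrib)

lemma square_integrable_add:
  assumes "square_integrable M f" "square_integrable M g"
  shows "square_integrable M (\<lambda>x. f x + g x)"
proof -
  have "integrable M (\<lambda>x. (f x)\<^sup>2 + (g x)\<^sup>2 + 2 * (f x * g x))"
    using assms square_integrable_mult[OF assms] by (simp add: square_integrable_def)
  moreover have "(\<lambda>x. (f x)\<^sup>2 + (g x)\<^sup>2 + 2 * (f x * g x)) = (\<lambda>x. (f x + g x)\<^sup>2)"
    by (auto simp: power2_sum)
  ultimately show ?thesis using assms by (auto simp: square_integrable_def)
qed

lemma square_integrable_diff: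
  assumes "square_integrable M f" "square_integrable M g"
  shows "square_integrable M (\<lambda>x. f x - g x)"
  using square_integrable_add[OF assms(1) square_integrable_cmult[OF assms(2), of "-1"]] by simp

lemma square_integrable_sum:
  "(\<And>i. i \<in> I \<Longrightarrow> square_integrable M (f i)) \<Longrightarrow> square_integrable M (\<lambda>x. \<Sum>i\<in>I. f i x)"
proof (induction I rule: infinite_finite_induct)
  case (insert i I)
  then show ?case by (simp add: square_integrable_add)
qed (simp_all add: square_integrable_def)

text \<open>The fourth moment is expressed through the square, which reduces its closure properties
  to those of \<open>square_integrable\<close>.\<close>

definition fourth_integrable :: "'a measure \<Rightarrow> ('a \<Rightarrow> real) \<Rightarrow> bool" where
  "fourth_integrable M f \<longleftrightarrow> f \<in> borel_measurable M \<and> square_integrable M (\<lambda>x. (f x)\<^sup>2)"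

lemma fourth_integrable_measurable: "fourth_integrable M f \<Longrightarrow> f \<in> borel_measurable M"
  and fourth_integrable_square: "fourth_integrable M f \<Longrightarrow> square_integrable M (\<lambda>x. (f x)\<^sup>2)"
  by (simp_all add: fourth_integrable_def)

lemma fourth_integrable_mult:
  assumes "fourth_integrable M f" "fourth_integrable M g"
  shows "square_integrable M (\<lambda>x. f x * g x)"
  using assms square_integrable_mult[of M "\<lambda>x. (f x)\<^sup>2" "\<lambda>x. (g x)\<^sup>2"]
  by (auto simp: fourth_integrable_def square_integrable_def power_mult_distrib)

lemma fourth_integrable_cmult: "fourth_integrable M f \<Longrightarrow> fourth_integrable M (\<lambda>x. c * f x)"
  by (auto simp: fourth_integrable_def power_mult_distrib square_integrable_cmult)

lemma fourth_integrable_add: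
  assumes "fourth_integrable M f" "fourth_integrable M g"
  shows "fourth_integrable M (\<lambda>x. f x + g x)"
proof -
  have "square_integrable M (\<lambda>x. ((f x)\<^sup>2 + (g x)\<^sup>2) + 2 * (f x * g x))"
    using assms by (intro square_integrable_add square_integrable_cmult fourth_integrable_mult
        fourth_integrable_square)
  moreover have "(\<lambda>x. (f x)\<^sup>2 + (g x)\<^sup>2 + 2 * (f x * g x)) = (\<lambda>x. (f x + g x)\<^sup>2)"
    by (auto simp: power2_sum)
  ultimately show ?thesis using assms by (auto simp: fourth_integrable_def)
qed

lemma fourth_integrable_diff:
  assumes "fourth_integrable M f" "fourth_integrable M g"
  shows "fourth_integrable M (\<lambda>x. f x - g x)"
  using fourth_integrable_add[OF assms(1) fourth_integrable_cmult[OF assms(2), of "-1"]] by simp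

lemma fourth_integrable_sum:
  "(\<And>i. i \<in> I \<Longrightarrow> fourth_integrable M (f i)) \<Longrightarrow> fourth_integrable M (\<lambda>x. \<Sum>i\<in>I. f i x)"
proof (induction I rule: infinite_finite_induct)
  case (insert i I)
  then show ?case by (simp add: fourth_integrable_add)
qed (simp_all add: fourth_integrable_def square_integrable_def)

context prob_space
begin

lemma square_integrable_const: "square_integrable M (\<lambda>_. c)"
  by (simp add: square_integrable_def)

lemma fourth_integrable_const: "fourth_integrable M (\<lambda>_. c)"
  by (simp add: fourth_integrable_def square_integrable_const)

lemma square_integrable_imp_integrable':
  "square_integrable M f \<Longrightarrow> integrable M f"
  using square_integrable_mult[OF _ square_integrable_const[of 1]] by simp

lemma fourth_integrable_imp_square_integrable: "fourth_integrable M f \<Longrightarrow> square_integrable M f"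
  using fourth_integrable_mult[OF _ fourth_integrable_const[of 1]] by simp

end

section \<open>Moments and limit laws of sample means\<close>

locale iid_sample = prob_space N for N :: "'b measure" +
  fixes t :: "nat \<Rightarrow> 'b \<Rightarrow> 'c" and P :: "'c measure"
  assumes indep: "indep_vars (\<lambda>_. P) t UNIV" and law: "distr N P (t j) = P"
begin

lemma t_measurable [measurable]: "t j \<in> measurable N P"
  using indep unfolding indep_vars_def by auto

sublocale P: prob_space P
  using prob_space_distr[OF t_measurable[of 0]] by (simp add: law)

abbreviation smean :: "nat \<Rightarrow> ('c \<Rightarrow> real) \<Rightarrow> 'b \<Rightarrow> real" where
  "smean m g w \<equiv> sample_mean m (\<lambda>j. t j w) g"

lemma smean_measurable [measurable]:
  assumes [measurable]: "g \<in> borel_measurable P"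
  shows "smean m g \<in> borel_measurable N"
  unfolding sample_mean_def by measurable

text \<open>\<open>P\<close> is both the target space of \<open>t j\<close> and its law, so the
  image measure of \<open>N\<close> under \<open>t j\<close> is \<open>P\<close> itself.\<close>

lemma expectation_sample:
  fixes g :: "'c \<Rightarrow> real"
  assumes "g \<in> borel_measurable P"
  shows "expectation (\<lambda>w. g (t j w)) = P.expectation g"
  using integral_distr[OF t_measurable assms, of j] by (simp add: law)

lemma integrable_sample:
  fixes g :: "'c \<Rightarrow> real"
  assumes "integrable P g"
  shows "integrable N (\<lambda>w. g (t j w))"
  using integrable_distr[OF t_measurable, of j g] assms by (simp add: law)

lemma square_integrable_sample: "square_integrable P g \<Longrightarrow> square_integrable N (\<lambda>w. g (t j w))"
  unfolding square_integrable_def using integrable_sample by (auto intro: integrable_sample)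

lemma indep_sample:
  assumes "g \<in> borel_measurable P"
  shows "indep_vars (\<lambda>_. borel) (\<lambda>j w. g (t j w)) UNIV"
  using indep_vars_compose2[OF indep, of "\<lambda>_. g" "\<lambda>_. borel"] assms by simp

lemma square_integrable_smean: "square_integrable P g \<Longrightarrow> square_integrable N (smean m g)"
  unfolding sample_mean_def
  by (intro square_integrable_cmult square_integrable_sum square_integrable_sample)

text \<open>In the double sum the mixed terms vanish by independence and centring, and the diagonal
  contributes \<open>m\<close> equal terms against the factor \<open>1 / m\<^sup>2\<close>. For
  \<open>m = 0\<close> both sides are \<open>0\<close>.\<close>

lemma expectation_smean_square:
  assumes g: "square_integrable P g" and 0: "P.expectation g = 0"
  shows "expectation (\<lambda>w. (smean m g w)\<^sup>2) = P.expectation (\<lambda>x. (g x)\<^sup>2) / real m"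
proof -
  note [measurable] = square_integrable_measurable[OF g]
  let ?v = "P.expectation (\<lambda>x. (g x)\<^sup>2)"
  have I: "integrable N (\<lambda>w. g (t i w) * g (t j w))" for i j
    by (intro square_integrable_mult square_integrable_sample g)
  have E: "expectation (\<lambda>w. g (t i w) * g (t j w)) = (if i = j then ?v else 0)" for i j
  proof (cases "i = j")
    case True
    then show ?thesis
      using expectation_sample[of "\<lambda>x. (g x)\<^sup>2" j] by (simp add: power2_eq_square)
  next
    case False
    \<comment> \<open>Independence is applied to the subfamily \<open>{i,j}\<close>, a genuine pair
      because \<open>i \<noteq> j\<close>.\<close>
    have "expectation (\<lambda>w. \<Prod>k\<in>{i,j}. g (t k w)) = (\<Prod>k\<in>{i,j}. expectation (\<lambda>w. g (t k w)))"
      by (rule indep_vars_lebesgue_integral)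
        (auto intro!: indep_vars_subset[OF indep_sample] integrable_sample
          P.square_integrable_imp_integrable' g)
    then show ?thesis using False by (simp add: expectation_sample 0)
  qed
  have "(smean m g w)\<^sup>2 = (1 / real m)\<^sup>2 * (\<Sum>i<m. \<Sum>j<m. g (t i w) * g (t j w))" for w
    by (simp add: sample_mean_def power_mult_distrib power2_eq_square sum_product)
  then have "expectation (\<lambda>w. (smean m g w)\<^sup>2)
      = (1 / real m)\<^sup>2 * (\<Sum>i<m. \<Sum>j<m. expectation (\<lambda>w. g (t i w) * g (t j w)))"
    using I by (simp add: Bochner_Integration.integral_sum)
  also have "\<dots> = ?v / real m"
    by (simp add: E power2_eq_square)
  finally show ?thesis .
qed

text \<open>By \<open>\<bar>a * b\<bar> \<le> (a\<^sup>2 + b\<^sup>2) / 2\<close> the product is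
  controlled in mean by two second moments of order \<open>1 / m\<close>; the factor
  \<open>sqrt (real m)\<close> leaves order \<open>1 / sqrt (real m)\<close>.\<close>

lemma sqrt_smean_mult_in_prob_zero:
  assumes g: "square_integrable P g" and g0: "P.expectation g = 0"
    and h: "square_integrable P h" and h0: "P.expectation h = 0"
  shows "in_prob_zero (\<lambda>m w. sqrt (real m) * (smean m g w * smean m h w))"
proof (rule in_prob_zero_L1)
  note [measurable] = square_integrable_measurable[OF g] square_integrable_measurable[OF h]
  note sg = square_integrable_smean[OF g] and sh = square_integrable_smean[OF h]
  have I: "integrable N (\<lambda>w. smean m g w * smean m h w)" for m
    by (rule square_integrable_mult[OF sg sh])
  then show "integrable N (\<lambda>w. sqrt (real m) * (smean m g w * smean m h w))" for m by simp
  let ?c = "(P.expectation (\<lambda>x. (g x)\<^sup>2) + P.expectation (\<lambda>x. (h x)\<^sup>2)) / 2"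
  have bound: "expectation (\<lambda>w. \<bar>sqrt (real m) * (smean m g w * smean m h w)\<bar>)
      \<le> ?c * (sqrt (real m) / real m)" for m
  proof -
    have ag: "\<bar>c * (a * b)\<bar> \<le> c * ((a\<^sup>2 + b\<^sup>2) / 2)" if "c \<ge> 0" for a b c :: real
    proof -
      have "\<bar>a * b\<bar> \<le> (a\<^sup>2 + b\<^sup>2) / 2"
        using zero_le_power2[of "\<bar>a\<bar> - \<bar>b\<bar>"] by (simp add: power2_diff abs_mult)
      from mult_left_mono[OF this that] show ?thesis using that by (simp only: abs_mult[of c] abs_of_nonneg)
    qed
    have "expectation (\<lambda>w. \<bar>sqrt (real m) * (smean m g w * smean m h w)\<bar>)
        \<le> expectation (\<lambda>w. sqrt (real m) * (((smean m g w)\<^sup>2 + (smean m h w)\<^sup>2) / 2))"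
      using square_integrable_square[OF sg] square_integrable_square[OF sh]
      by (intro integral_mono integrable_abs integrable_mult_right I ag) auto
    also have "\<dots> = ?c * (sqrt (real m) / real m)"
      using square_integrable_square[OF sg] square_integrable_square[OF sh]
      by (cases "m = 0") (simp_all add: expectation_smean_square g g0 h h0 field_simps)
    finally show ?thesis .
  qed
  have "(\<lambda>m. inverse (sqrt (real m))) \<longlonglongrightarrow> 0"
    by (intro tendsto_inverse_0_at_top filterlim_compose[OF sqrt_at_top filterlim_real_sequentially])
  moreover have "sqrt (real m) / real m = inverse (sqrt (real m))" for m
    by (cases "m = 0") (simp_all add: field_simps)
  ultimately have lim: "(\<lambda>m. ?c * (sqrt (real m) / real m)) \<longlonglongrightarrow> 0"
    by (simp only: tendsto_mult_right_zero)
  show "(\<lambda>m. expectation (\<lambda>w. \<bar>sqrt (real m) * (smean m g w * smean m h w)\<bar>)) \<longlonglongrightarrow> 0"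
    by (rule tendsto_sandwich[OF always_eventually always_eventually tendsto_const lim])
      (simp, rule allI, rule bound)
qed

text \<open>A weak law of large numbers, taken from the preceding estimate with both functions equal
  to \<open>g\<close>: for \<open>m \<ge> 1\<close> the factor \<open>sqrt (real m)\<close> is at
  least \<open>1\<close>, so the squared mean is dominated. The domination principle is used with
  both comparison sequences equal.\<close>

lemma smean_in_prob_zero:
  assumes g: "square_integrable P g" and g0: "P.expectation g = 0"
  shows "in_prob_zero (\<lambda>m. smean m g)"
proof (rule in_prob_zero_dominated)
  note [measurable] = square_integrable_measurable[OF g]
  show "in_prob_zero (\<lambda>m w. sqrt (real m) * (smean m g w * smean m g w))"
    "in_prob_zero (\<lambda>m w. sqrt (real m) * (smean m g w * smean m g w))"
    by (rule sqrt_smean_mult_in_prob_zero[OF assms assms])+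
  show "random_variable borel (\<lambda>w. sqrt (real m) * (smean m g w * smean m g w))"
    "random_variable borel (\<lambda>w. sqrt (real m) * (smean m g w * smean m g w))" for m by measurable
  fix e :: real assume e: "e > 0"
  have "\<bar>x\<bar> < e" if "\<bar>sqrt (real m) * (x * x)\<bar> < e\<^sup>2" "m \<ge> 1" for x m
  proof -
    have "x\<^sup>2 \<le> sqrt (real m) * (x * x)" using that(2) by (simp add: power2_eq_square mult_le_cancel_right1)
    then have "\<bar>x\<bar>\<^sup>2 < e\<^sup>2" using that(1) by simp
    then show ?thesis using e by (rule_tac power2_less_imp_less) auto
  qed
  then show "\<exists>d>0. \<forall>\<^sub>F m in sequentially. \<forall>w\<in>space N.
      \<bar>sqrt (real m) * (smean m g w * smean m g w)\<bar> < d \<longrightarrow>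
      \<bar>sqrt (real m) * (smean m g w * smean m g w)\<bar> < d \<longrightarrow> \<bar>smean m g w\<bar> < e"
    using e by (intro exI[of _ "e\<^sup>2"] conjI eventually_sequentiallyI[of 1]) auto
qed

text \<open>The classical central limit theorem covers positive variance; zero variance is treated
  apart and yields the Dirac mass at \<open>0\<close>.\<close>

lemma smean_clt:
  assumes g: "square_integrable P g" and g0: "P.expectation g = 0"
  shows "weak_conv_m (\<lambda>m. distr N borel (\<lambda>w. sqrt (real m) * smean m g w))
    (gaussian 0 (P.expectation (\<lambda>x. (g x)\<^sup>2)))"
proof -
  note [measurable] = square_integrable_measurable[OF g]
  define v where "v = P.expectation (\<lambda>x. (g x)\<^sup>2)"
  have v0: "v \<ge> 0" by (simp add: v_def)
  show ?thesis
  proof (cases "v = 0")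
    case True
    \<comment> \<open>The square of the scaled mean has expectation at most \<open>v = 0\<close>,
      hence is null in probability, and so is its root.\<close>
    have "in_prob_zero (\<lambda>m w. sqrt (real m) * smean m g w)"
    proof (rule in_prob_zero_dominated)
      let ?X = "\<lambda>m w. real m * (smean m g w)\<^sup>2"
      have I: "integrable N (?X m)" for m
        using square_integrable_square[OF square_integrable_smean[OF g]] by simp
      have "expectation (\<lambda>w. \<bar>?X m w\<bar>) = 0" for m
        using expectation_smean_square[OF g g0, of m] True by (simp add: abs_mult v_def)
      then have "(\<lambda>m. expectation (\<lambda>w. \<bar>?X m w\<bar>)) \<longlonglongrightarrow> 0" by (simp only: tendsto_const)
      then show "in_prob_zero ?X" "in_prob_zero ?X" by (rule in_prob_zero_L1[OF I])+
      show "random_variable borel (?X m)" "random_variable borel (?X m)" for m by measurable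
      fix e :: real assume e: "e > 0"
      have "\<bar>sqrt (real m) * x\<bar> < e" if "\<bar>real m * x\<^sup>2\<bar> < e\<^sup>2" for m x
      proof -
        have "\<bar>sqrt (real m) * x\<bar>\<^sup>2 < e\<^sup>2" using that by (simp add: power_mult_distrib)
        then show ?thesis using e by (rule_tac power2_less_imp_less) auto
      qed
      then show "\<exists>d>0. \<forall>\<^sub>F m in sequentially. \<forall>w\<in>space N.
          \<bar>?X m w\<bar> < d \<longrightarrow> \<bar>?X m w\<bar> < d \<longrightarrow> \<bar>sqrt (real m) * smean m g w\<bar> < e"
        using e by (intro exI[of _ "e\<^sup>2"] conjI always_eventually) auto
    qed
    \<comment> \<open>The scaled mean is viewed as a null perturbation of the constant sequence
      \<open>0\<close>.\<close>
    moreover have "weak_conv_m (\<lambda>m. distr N borel (\<lambda>w. 0)) (gaussian 0 0)"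
      by (simp add: gaussian_def weak_conv_m_def weak_conv_def)
    ultimately have "weak_conv_m (\<lambda>m. distr N borel (\<lambda>w. 0 + sqrt (real m) * smean m g w)) (gaussian 0 0)"
      by (intro slutsky_add real_distribution_gaussian) auto
    then show ?thesis using True by (simp add: v_def)
  next
    case False
    define s where "s = sqrt v"
    have s: "s > 0" "s\<^sup>2 = v" using False v0 by (auto simp: s_def)
    have "weak_conv_m (\<lambda>m. distr N borel (\<lambda>w. (\<Sum>i<m. g (t i w)) / sqrt (m * s\<^sup>2)))
      std_normal_distribution"
    proof (rule central_limit_theorem_zero_mean[where \<mu> = "distr P borel g"])
      show "indep_vars (\<lambda>i. borel) (\<lambda>i w. g (t i w)) UNIV" by (rule indep_sample) measurable
      show m0: "expectation (\<lambda>w. g (t n w)) = 0" for n by (simp add: expectation_sample g0)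
      show "0 < s" by (rule s)
      show "integrable N (\<lambda>w. (g (t n w))\<^sup>2)" for n
        by (intro integrable_sample square_integrable_square g)
      show "variance (\<lambda>w. g (t n w)) = s\<^sup>2" for n
        unfolding m0 using expectation_sample[of "\<lambda>x. (g x)\<^sup>2" n] by (simp add: s v_def)
      show "distr N borel (\<lambda>w. g (t n w)) = distr P borel g" for n
        using distr_distr[of g P borel "t n" N] by (simp add: law comp_def)
    qed
    then have "weak_conv_m (\<lambda>m. distr N borel (\<lambda>w. s * ((\<Sum>i<m. g (t i w)) / sqrt (m * s\<^sup>2))))
      (gaussian 0 (s\<^sup>2))"
      by (rule weak_conv_scale_std_normal) (use s in auto)
    \<comment> \<open>Undoing the standardisation; at \<open>m = 0\<close> both sides are
      \<open>0\<close> by the convention for division by zero.\<close>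
    moreover have "s * ((\<Sum>i<m. g (t i w)) / sqrt (m * s\<^sup>2)) = sqrt (real m) * smean m g w" for m w
      using s(1) by (cases "m = 0") (simp_all add: sample_mean_def real_sqrt_mult field_simps)
    ultimately show ?thesis by (simp add: s v_def)
  qed
qed

end

subsection \<open>Asymptotic normality of the sensitivity estimator\<close>

text \<open>Empirical covariances are invariant under shifts. With \<open>a\<close> and
  \<open>b\<close> the true means, the estimator can be rewritten in centred functions. For
  \<open>m > 0\<close> the sample mean of a constant is that constant.\<close>

lemma sample_mean_centered_mult:
  assumes m: "m > 0"
  shows "sample_mean m t (\<lambda>x. g x * h x) - sample_mean m t g * sample_mean m t h =
    sample_mean m t (\<lambda>x. (g x - a) * (h x - b)) -
    sample_mean m t (\<lambda>x. g x - a) * sample_mean m t (\<lambda>x. h x - b)"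
proof -
  have 1: "sample_mean m t (\<lambda>x. g x - a) = sample_mean m t g - a" for g :: "'a \<Rightarrow> real" and a
    using m by (simp add: sample_mean_def sum_subtractf field_simps)
  have "sample_mean m t (\<lambda>x. (g x - a) * (h x - b)) =
    sample_mean m t (\<lambda>x. g x * h x) - b * sample_mean m t g - a * sample_mean m t h + a * b"
    using m by (simp add: sample_mean_def algebra_simps sum.distrib sum_subtractf sum_distrib_left)
  then show ?thesis by (simp add: 1 algebra_simps)
qed

lemma sample_mean_diff: "sample_mean m t (\<lambda>x. g x - h x) = sample_mean m t g - sample_mean m t h"
  and sample_mean_add: "sample_mean m t (\<lambda>x. g x + h x) = sample_mean m t g + sample_mean m t h"
  and sample_mean_cmult: "sample_mean m t (\<lambda>x. c * g x) = c * sample_mean m t g"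
  by (simp_all add: sample_mean_def sum_subtractf sum.distrib sum_distrib_left algebra_simps)

text \<open>The linearisation of the estimator's error at the law of the sample.\<close>

definition sensitivity_influence ::
    "'a measure \<Rightarrow> ('a \<Rightarrow> 'b) \<Rightarrow> ('b \<Rightarrow> real) \<Rightarrow> ('b \<Rightarrow> real) \<Rightarrow> ('b \<Rightarrow> real) \<Rightarrow> 'b \<Rightarrow> real" where
  "sensitivity_influence M X g h f x =
    (let G = g x - prob_space.expectation M (\<lambda>w. g (X w));
         H = h x - prob_space.expectation M (\<lambda>w. h (X w));
         F = f x - prob_space.expectation M (\<lambda>w. f (X w))
     in (G\<^sup>2 + G * H - sensitivity M X g h f * F\<^sup>2) / prob_space.variance M (\<lambda>w. f (X w)))"

text \<open>The scaled error is the scaled mean of \<open>y\<close> plus a remainder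
  \<open>R\<close>. The central limit theorem handles the first, and \<open>R = num / B\<close> is
  null because each term of \<open>num\<close> contains two centred means but only one factor
  \<open>sqrt (real m)\<close>.\<close>

theorem (in iid_sample) sensitivity_estimator_clt:
  assumes g: "fourth_integrable P g" and h: "fourth_integrable P h" and f: "fourth_integrable P f"
    and var: "P.variance f \<noteq> 0"
  defines "y \<equiv> sensitivity_influence P (\<lambda>x. x) g h f"
  shows "weak_conv_m (\<lambda>m. distr N borel (\<lambda>w. sqrt (real m) *
      (sensitivity_estimator m (\<lambda>j. t j w) g h f - sensitivity P (\<lambda>x. x) g h f)))
    (gaussian 0 (P.expectation (\<lambda>x. (y x)\<^sup>2)))"
proof -
  note [measurable] = fourth_integrable_measurable[OF g] fourth_integrable_measurable[OF h]
    fourth_integrable_measurable[OF f]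
  define G where "G x = g x - P.expectation g" for x
  define H where "H x = h x - P.expectation h" for x
  define F where "F x = f x - P.expectation f" for x
  define V where "V = P.expectation (\<lambda>x. (F x)\<^sup>2)"
  define s where "s = sensitivity P (\<lambda>x. x) g h f"
  \<comment> \<open>Centring the square of \<open>F\<close> makes the deviation of \<open>B\<close>
    from \<open>V\<close> equal to \<open>smean m Q w - (smean m F w)\<^sup>2\<close> for
    \<open>m > 0\<close>.\<close>
  define Q where "Q x = (F x)\<^sup>2 - V" for x
  have V: "V \<noteq> 0" using var by (simp add: V_def F_def)
  have y: "y x = 1 / V * ((G x)\<^sup>2 + G x * H x - s * (F x)\<^sup>2)" for x
    by (simp add: y_def sensitivity_influence_def G_def H_def F_def V_def s_def Let_def)
  have s: "s = (P.expectation (\<lambda>x. (G x)\<^sup>2) + P.expectation (\<lambda>x. G x * H x)) / V"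
    by (simp add: s_def sensitivity_def covar_def G_def H_def F_def V_def)

  have G4: "fourth_integrable P G" and H4: "fourth_integrable P H" and F4: "fourth_integrable P F"
    unfolding G_def H_def F_def
    by (intro fourth_integrable_diff P.fourth_integrable_const g h f)+
  note [measurable] = fourth_integrable_measurable[OF G4] fourth_integrable_measurable[OF H4]
    fourth_integrable_measurable[OF F4]
  note G2 = P.fourth_integrable_imp_square_integrable[OF G4]
  note H2 = P.fourth_integrable_imp_square_integrable[OF H4]
  note F2 = P.fourth_integrable_imp_square_integrable[OF F4]
  have Q2: "square_integrable P Q"
    unfolding Q_def by (intro square_integrable_diff P.square_integrable_const
      fourth_integrable_square F4)
  have y2: "square_integrable P y"
    unfolding y by (intro square_integrable_cmult square_integrable_add square_integrable_diff
      fourth_integrable_mult fourth_integrable_square G4 H4 F4)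
  note [measurable] = square_integrable_measurable[OF Q2] square_integrable_measurable[OF y2]

  have int: "integrable P g" "integrable P h" "integrable P f"
    using g h f by (auto intro!: P.square_integrable_imp_integrable'
      P.fourth_integrable_imp_square_integrable)
  have G0: "P.expectation G = 0" and H0: "P.expectation H = 0" and F0: "P.expectation F = 0"
    unfolding G_def[abs_def] H_def[abs_def] F_def[abs_def] using int by (simp_all add: P.prob_space)
  have Q0: "P.expectation Q = 0"
    unfolding Q_def[abs_def] using square_integrable_square[OF F2] by (simp add: V_def P.prob_space)
  \<comment> \<open>The choice of \<open>s\<close> makes \<open>s * V\<close> equal to the
    expectation of \<open>(G x)\<^sup>2 + G x * H x\<close>, which cancels the mean of
    \<open>y\<close>.\<close>
  have y0: "P.expectation y = 0"
    unfolding y[abs_def] using square_integrable_square[OF F2] square_integrable_square[OF G2]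
      square_integrable_mult[OF G2 H2] V
    by (simp add: s V_def[symmetric])

  define B where "B m w = smean m (\<lambda>x. (f x)\<^sup>2) w - (smean m f w)\<^sup>2" for m w
  define E where "E m w = sensitivity_estimator m (\<lambda>j. t j w) g h f" for m w
  define R where "R m w = sqrt (real m) * (E m w - s) - sqrt (real m) * smean m y w" for m w
  define p where "p m u v w = sqrt (real m) * (smean m u w * smean m v w)" for m u v w
  \<comment> \<open>This is \<open>R m w * B m w\<close> after all first-order terms have cancelled.
    Signs are written as factors \<open>- 1\<close> so that the rules for sums and multiples
    match.\<close>
  define num where "num m w = p m F F w * smean m y w + (- 1) * p m Q y w
    + (- 1) * p m G G w + (- 1) * p m G H w + s * p m F F w" for m w
  have [measurable]: "random_variable borel (B m)" "random_variable borel (E m)" for m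
    unfolding B_def[abs_def] E_def[abs_def] sensitivity_estimator_def by measurable
  have [measurable]: "random_variable borel (p m u v)"
    if [measurable]: "u \<in> borel_measurable P" "v \<in> borel_measurable P" for m u v
    unfolding p_def[abs_def] by measurable

  have B_eq: "B m w = V + smean m Q w - (smean m F w)\<^sup>2" if "m > 0" for m w
  proof -
    have "smean m Q w = smean m (\<lambda>x. F x * F x) w - V"
      unfolding Q_def sample_mean_diff power2_eq_square using that by (simp add: sample_mean_def)
    then show ?thesis
      using sample_mean_centered_mult[OF that, of "\<lambda>j. t j w" f f "P.expectation f" "P.expectation f"]
      by (simp add: B_def power2_eq_square F_def[abs_def])
  qed
  have E_eq: "E m w = (smean m (\<lambda>x. (G x)\<^sup>2) w - (smean m G w)\<^sup>2
      + smean m (\<lambda>x. G x * H x) w - smean m G w * smean m H w) / B m w" if "m > 0" for m w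
    using sample_mean_centered_mult[OF that, of "\<lambda>j. t j w" g g "P.expectation g" "P.expectation g"]
      sample_mean_centered_mult[OF that, of "\<lambda>j. t j w" g h "P.expectation g" "P.expectation h"]
    by (simp add: E_def B_def sensitivity_estimator_def power2_eq_square G_def[abs_def] H_def[abs_def])
  have y_eq: "smean m y w = (smean m (\<lambda>x. (G x)\<^sup>2) w + smean m (\<lambda>x. G x * H x) w
      - s * (smean m Q w + V)) / V" if "m > 0" for m w
  proof -
    have "smean m (\<lambda>x. (F x)\<^sup>2) w = smean m Q w + V"
      unfolding Q_def sample_mean_diff using that by (simp add: sample_mean_def)
    then show ?thesis unfolding y[abs_def] sample_mean_cmult sample_mean_add sample_mean_diff by simp
  qed
  have R_eq: "R m w = num m w / B m w" if "m > 0" "B m w \<noteq> 0" for m w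
  proof -
    have "V * smean m y w = smean m (\<lambda>x. (G x)\<^sup>2) w + smean m (\<lambda>x. G x * H x) w
      - s * (smean m Q w + V)" using y_eq[OF that(1)] V by simp
    then have eq: "E m w * B m w = V * smean m y w + s * (smean m Q w + V) - (smean m G w)\<^sup>2
      - smean m G w * smean m H w"
      using E_eq[OF that(1)] that(2) by simp
    have "R m w * B m w = sqrt (real m) * (E m w * B m w - s * B m w - smean m y w * B m w)"
      by (simp add: R_def algebra_simps)
    \<comment> \<open>Inserting \<open>eq\<close> and \<open>B_eq\<close> cancels
      \<open>V * smean m y w\<close>, \<open>s * V\<close> and
      \<open>s * smean m Q w\<close>.\<close>
    also have "\<dots> = num m w"
      unfolding eq unfolding B_eq[OF that(1)] num_def p_def by (simp add: algebra_simps power2_eq_square)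
    finally show ?thesis using that(2) by (simp add: field_simps)
  qed

  have p0: "in_prob_zero (\<lambda>m. p m u v)" if "square_integrable P u" "P.expectation u = 0"
    "square_integrable P v" "P.expectation v = 0" for u v
    unfolding p_def by (rule sqrt_smean_mult_in_prob_zero[OF that])
  have "in_prob_zero num"
    unfolding num_def[abs_def]
    by (intro in_prob_zero_add in_prob_zero_cmult in_prob_zero_mult p0 smean_in_prob_zero
        G0 H0 F0 Q0 y0 G2 H2 F2 Q2 y2; measurable)
  moreover have "in_prob_zero (\<lambda>m w. B m w - V)"
  proof (rule in_prob_zero_dominated)
    show "in_prob_zero (\<lambda>m. smean m Q)" "in_prob_zero (\<lambda>m w. smean m F w * smean m F w)"
      by (intro in_prob_zero_mult smean_in_prob_zero F0 Q0 F2 Q2; measurable)+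
    show "random_variable borel (smean m Q)" "random_variable borel (\<lambda>w. smean m F w * smean m F w)"
      for m by measurable
    fix e :: real assume "e > 0"
    moreover have "\<bar>B m w - V\<bar> < e" if "m \<ge> 1" "\<bar>smean m Q w\<bar> < e / 2"
      "\<bar>smean m F w * smean m F w\<bar> < e / 2" for m w
    proof -
      have "B m w - V = smean m Q w - smean m F w * smean m F w"
        using that(1) by (simp add: B_eq power2_eq_square)
      then show ?thesis using that(2,3) by linarith
    qed
    ultimately show "\<exists>d>0. \<forall>\<^sub>F m in sequentially. \<forall>w\<in>space N. \<bar>smean m Q w\<bar> < d \<longrightarrow>
        \<bar>smean m F w * smean m F w\<bar> < d \<longrightarrow> \<bar>B m w - V\<bar> < e"
      by (intro exI[of _ "e / 2"] conjI eventually_sequentiallyI[of 1]) auto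
  qed
  ultimately have R: "in_prob_zero R"
  proof (rule in_prob_zero_divide)
    show "random_variable borel (num m)" for m unfolding num_def[abs_def] by measurable
    show "\<forall>\<^sub>F m in sequentially. \<forall>w\<in>space N. B m w \<noteq> 0 \<longrightarrow> R m w = num m w / B m w"
      by (rule eventually_sequentiallyI[of 1]) (simp add: R_eq)
  qed (use V in measurable)
  have "weak_conv_m (\<lambda>m. distr N borel (\<lambda>w. sqrt (real m) * smean m y w + R m w))
    (gaussian 0 (P.expectation (\<lambda>x. (y x)\<^sup>2)))"
    by (rule slutsky_add[OF real_distribution_gaussian smean_clt[OF y2 y0] R])
      (simp_all add: R_def[abs_def])
  then show ?thesis by (simp add: R_def E_def s_def)
qed

subsection \<open>Sensitivity estimates for the posterior model\<close>

lemma covar_distr: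
  assumes X: "X \<in> measurable M S" and [measurable]: "g \<in> borel_measurable S" "h \<in> borel_measurable S"
  shows "covar (distr M S X) g h = covar M (\<lambda>w. g (X w)) (\<lambda>w. h (X w))"
  by (simp add: covar_def integral_distr[OF X])

text \<open>The limit theorem for samples works on the law with the identity as input, whereas the
  final statement refers to \<open>M\<close> and \<open>X\<close>.\<close>

lemma sensitivity_distr:
  assumes X: "X \<in> measurable M S" and [measurable]: "g \<in> borel_measurable S"
    "h \<in> borel_measurable S" "f \<in> borel_measurable S"
  shows "sensitivity (distr M S X) (\<lambda>x. x) g h f = sensitivity M X g h f"
  by (simp add: sensitivity_def covar_distr[OF X] integral_distr[OF X])

lemma sensitivity_influence_distr:
  assumes X: "X \<in> measurable M S" and [measurable]: "g \<in> borel_measurable S"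
    "h \<in> borel_measurable S" "f \<in> borel_measurable S"
  shows "sensitivity_influence (distr M S X) (\<lambda>x. x) g h f = sensitivity_influence M X g h f"
  by (simp add: sensitivity_influence_def[abs_def] sensitivity_distr[OF X] integral_distr[OF X])

section \<open>The gradient of \<open>phi\<close>\<close>

lemma vector_6 [simp]:
  "(vector [a, b, c, d, e, f] :: 'a::zero^6) $ 1 = a"
  "(vector [a, b, c, d, e, f] :: 'a::zero^6) $ 2 = b"
  "(vector [a, b, c, d, e, f] :: 'a::zero^6) $ 3 = c"
  "(vector [a, b, c, d, e, f] :: 'a::zero^6) $ 4 = d"
  "(vector [a, b, c, d, e, f] :: 'a::zero^6) $ 5 = e"
  "(vector [a, b, c, d, e, f] :: 'a::zero^6) $ 6 = f"
  by (simp_all add: vector_def)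

text \<open>A counting argument: the listed numerals are distinct, \<open>6\<close> being the zero
  of the index type.\<close>

lemma UNIV_6: "(UNIV :: 6 set) = {1, 2, 3, 4, 5, 6}"
proof -
  have "card {1, 2, 3, 4, 5, 6 :: 6} = CARD(6)" by simp
  then show ?thesis by (intro card_subset_eq[symmetric]) auto
qed

lemma sum_6: "(\<Sum>i\<in>(UNIV :: 6 set). q i) = q 1 + q 2 + q 3 + q 4 + q 5 + q 6"
  unfolding UNIV_6 by (simp add: add.assoc)

text \<open>Quotient rule for \<open>n / d\<close>: entries 3 and 5 come from the denominator, the
  others from the numerator.\<close>

definition grad_phi :: "real^6 \<Rightarrow> real^6" where
  "grad_phi u = (let d = u $ 5 - (u $ 3)\<^sup>2; n = u $ 4 - (u $ 1)\<^sup>2 + u $ 6 - u $ 1 * u $ 2 in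
    vector [(- 2 * u $ 1 - u $ 2) / d, - u $ 1 / d, 2 * u $ 3 * n / d\<^sup>2, 1 / d, - n / d\<^sup>2, 1 / d])"

text \<open>Two gradients induce the same linear form; evaluating it at their difference shows that
  this difference has norm zero.\<close>

lemma gradient_eqI:
  assumes "GDERIV f x :> D"
  shows "gradient f x = D"
  unfolding gradient_def
proof (rule the_equality)
  show "GDERIV f x :> D" by (rule assms)
  fix D' assume "GDERIV f x :> D'"
  then have "(\<lambda>h. h \<bullet> D') = (\<lambda>h. h \<bullet> D)"
    using assms unfolding gderiv_def by (rule has_derivative_unique)
  from fun_cong[OF this, of "D' - D"] have "(D' - D) \<bullet> (D' - D) = 0"
    by (simp only: inner_diff_right diff_self)
  then show "D' = D" by simp
qed

lemma gradient_phi: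
  assumes "u $ 5 - (u $ 3)\<^sup>2 \<noteq> 0"
  shows "gradient phi u = grad_phi u"
proof (rule gradient_eqI)
  define n where "n x = x $ 4 - (x $ 1)\<^sup>2 + x $ 6 - x $ 1 * x $ 2" for x :: "real^6"
  define d where "d x = x $ 5 - (x $ 3)\<^sup>2" for x :: "real^6"
  have comp: "((\<lambda>x. x $ i) has_derivative (\<lambda>v. v $ i)) (at u)" for i :: 6
    by (rule bounded_linear.has_derivative[OF bounded_linear_vec_nth has_derivative_ident])
  have n: "(n has_derivative (\<lambda>v. v $ 4 - 2 * u $ 1 * v $ 1 + v $ 6 - (u $ 1 * v $ 2 + v $ 1 * u $ 2))) (at u)"
    unfolding n_def[abs_def] power2_eq_square
    by (rule has_derivative_eq_rhs, (rule has_derivative_add has_derivative_diff has_derivative_mult comp)+)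
      (simp add: fun_eq_iff)
  have d: "(d has_derivative (\<lambda>v. v $ 5 - 2 * u $ 3 * v $ 3)) (at u)"
    unfolding d_def[abs_def] power2_eq_square
    by (rule has_derivative_eq_rhs, (rule has_derivative_diff has_derivative_mult comp)+)
      (simp add: fun_eq_iff)
  have d0: "d u \<noteq> 0" using assms by (simp add: d_def)
  have "((\<lambda>x. n x / d x) has_derivative (\<lambda>v. v \<bullet> grad_phi u)) (at u)"
  proof (rule has_derivative_eq_rhs[OF has_derivative_divide'[OF n d d0]], rule ext)
    fix v
    have g: "grad_phi u = vector [(- 2 * u $ 1 - u $ 2) / d u, - u $ 1 / d u, 2 * u $ 3 * n u / (d u)\<^sup>2,
        1 / d u, - n u / (d u)\<^sup>2, 1 / d u]"
      by (simp only: grad_phi_def d_def n_def Let_def)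
    show "((v $ 4 - 2 * u $ 1 * v $ 1 + v $ 6 - (u $ 1 * v $ 2 + v $ 1 * u $ 2)) * d u
        - n u * (v $ 5 - 2 * u $ 3 * v $ 3)) / (d u * d u) = v \<bullet> grad_phi u"
      unfolding g inner_vec_def sum_6 using d0 by (simp add: field_simps power2_eq_square)
  qed
  moreover have "phi = (\<lambda>x. n x / d x)" by (simp add: phi_def[abs_def] n_def d_def)
  ultimately show "GDERIV phi u :> grad_phi u" by (simp add: gderiv_def)
qed

text \<open>The square of the centred inner product expands into a double sum whose expectations are
  covariances. This turns the quadratic form of the limit variance into the variance of one real
  variable, so that a univariate limit theorem suffices.\<close>

lemma (in prob_space) inner_cov_matrix:
  fixes U :: "'a \<Rightarrow> real^'d"
  assumes U: "\<And>i. square_integrable M (\<lambda>w. U w $ i)"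
  shows "d \<bullet> (cov_matrix M U *v d) = variance (\<lambda>w. d \<bullet> U w)"
proof -
  define C where "C i w = U w $ i - expectation (\<lambda>w. U w $ i)" for i w
  have C: "square_integrable M (C i)" for i
    unfolding C_def[abs_def] by (intro square_integrable_diff U square_integrable_const)
  note I = square_integrable_imp_integrable'[OF U]
  have E: "expectation (\<lambda>w. d \<bullet> U w) = (\<Sum>i\<in>UNIV. d $ i * expectation (\<lambda>w. U w $ i))"
    using I by (simp add: inner_vec_def Bochner_Integration.integral_sum)
  have "d \<bullet> U w - expectation (\<lambda>w. d \<bullet> U w) = (\<Sum>i\<in>UNIV. d $ i * C i w)" for w
    unfolding E by (simp add: inner_vec_def C_def sum_subtractf right_diff_distrib)
  then have "(d \<bullet> U w - expectation (\<lambda>w. d \<bullet> U w))\<^sup>2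
      = (\<Sum>i\<in>UNIV. \<Sum>j\<in>UNIV. d $ i * d $ j * (C i w * C j w))" for w
    by (simp only: power2_eq_square sum_product) (intro sum.cong refl, simp)
  then have "variance (\<lambda>w. d \<bullet> U w)
      = expectation (\<lambda>w. \<Sum>i\<in>UNIV. \<Sum>j\<in>UNIV. d $ i * d $ j * (C i w * C j w))"
    by simp
  also have "\<dots> = (\<Sum>i\<in>UNIV. \<Sum>j\<in>UNIV. d $ i * d $ j * expectation (\<lambda>w. C i w * C j w))"
    using square_integrable_mult[OF C C] by (simp add: Bochner_Integration.integral_sum)
  also have "\<dots> = d \<bullet> (cov_matrix M U *v d)"
    unfolding inner_vec_def matrix_vector_mult_def cov_matrix_def covar_def C_def
    by (simp add: sum_distrib_left) (intro sum.cong refl, simp)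
  finally show ?thesis by simp
qed

section \<open>Measurability of the sample paths\<close>

lemma subvec_measurable: "subvec u \<in> measurable borel (Pi\<^sub>M u (\<lambda>_. borel))"
  unfolding subvec_def[abs_def] by (intro measurable_restrict) measurable

text \<open>Parameter integrals of jointly measurable functions are measurable. The second argument
  stays fixed since it only receives design coordinates.\<close>

lemma centered_kernel_measurable:
  assumes [measurable]: "(\<lambda>(w, w'). \<kappa> w w') \<in> borel_measurable (borel \<Otimes>\<^sub>M borel)"
    "d \<in> borel_measurable borel"
  shows "(\<lambda>x. centered_kernel d \<kappa> x x') \<in> borel_measurable borel"
  unfolding centered_kernel_def by measurable

lemma posterior_component_measurable:
  assumes k0: "\<And>i x'. (\<lambda>x. k0 i x x') \<in> borel_measurable borel"
    and Z: "(\<lambda>(\<eta>, y). Z v y \<eta>) \<in> borel_measurable (MZ \<Otimes>\<^sub>M Pi\<^sub>M v (\<lambda>_. borel))"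
    and \<omega>: "\<omega> \<in> space MZ"
  shows "(\<lambda>y. posterior_component \<sigma> k0 D z f0 Z0 Z v y \<omega>) \<in> borel_measurable (Pi\<^sub>M v (\<lambda>_. borel))"
proof -
  \<comment> \<open>Sections of a jointly measurable process at a fixed outcome are
    measurable.\<close>
  have [measurable]: "(\<lambda>y. Z v y \<omega>) \<in> borel_measurable (Pi\<^sub>M v (\<lambda>_. borel))"
    using measurable_compose[OF measurable_Pair1'[OF \<omega>] Z] by simp
  have [measurable]: "(\<lambda>y. k0 i (y i) x') \<in> borel_measurable (Pi\<^sub>M v (\<lambda>_. borel))" if "i \<in> v" for i x'
    by (rule measurable_compose[OF measurable_component_singleton[OF that] k0])
  show ?thesis
    unfolding posterior_component_def inner_vec_def by simp measurable
qed

theorem proposition4: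
  fixes M :: "'a measure" and X :: "'a \<Rightarrow> real^'p" and dens :: "real^'p \<Rightarrow> ennreal"
    and pX :: "'p \<Rightarrow> real \<Rightarrow> real"
    and kt k0 :: "'p \<Rightarrow> real \<Rightarrow> real \<Rightarrow> real" and k :: "real^'p \<Rightarrow> real^'p \<Rightarrow> real" and \<sigma> :: real
    and MZ :: "'w measure" and Z0 :: "'w \<Rightarrow> real"
    and Z :: "'p set \<Rightarrow> ('p \<Rightarrow> real) \<Rightarrow> 'w \<Rightarrow> real" and \<omega> :: 'w
    and D :: "(real^'p)^'n" and z :: "real^'n" and f0 :: real
    and fc :: "'p set \<Rightarrow> ('p \<Rightarrow> real) \<Rightarrow> real" and f fuc :: "real^'p \<Rightarrow> real" and u :: "'p set"
    and N :: "'b measure" and t :: "nat \<Rightarrow> 'b \<Rightarrow> real^'p"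
    and U :: "'a \<Rightarrow> real^6" and \<mu> :: "real^6" and \<Gamma> :: "real^6^6"
  assumes M: "prob_space M"
    and X_dens: "distributed M lborel X dens"
    and pX_nonneg: "\<And>i w. 0 \<le> pX i w"
    and pX_dens: "\<And>i. distributed M lborel (\<lambda>\<eta>. X \<eta> $ i) (\<lambda>w. ennreal (pX i w))"
    and kt_meas: "\<And>i. (\<lambda>(w, w'). kt i w w') \<in> borel_measurable (borel \<Otimes>\<^sub>M borel)"
    and kt_cov: "\<And>i. covariance_kernel (kt i)"
    and kt_int1: "\<And>i w. integrable lborel (\<lambda>w'. kt i w w' * pX i w')"
    and kt_int2: "\<And>i. integrable (lborel \<Otimes>\<^sub>M lborel) (\<lambda>(w, w'). kt i w w' * pX i w * pX i w')"
    and kt_nz: "\<And>i. (LINT (w, w')|(lborel \<Otimes>\<^sub>M lborel). kt i w w' * pX i w * pX i w') \<noteq> 0"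
    and k0: "k0 = (\<lambda>i. centered_kernel (pX i) (kt i))"
    and k: "k = anova_kernel \<sigma> k0"
    and \<sigma>: "\<sigma>\<^sup>2 > 0"
    and k_bdd: "bdd_above (range (\<lambda>(x, x'). k x x'))"
  \<comment> \<open>in the independence assumption, the index \<open>{}\<close> stands for \<open>Z0\<close>\<close>
    and MZ: "prob_space MZ"
    and Z0_rv: "Z0 \<in> borel_measurable MZ"
    and Z0_distr: "distr MZ borel Z0 = gaussian 0 (\<sigma>\<^sup>2)"
    and Z_meas: "\<And>v. v \<noteq> {} \<Longrightarrow>
      (\<lambda>(\<eta>, y). Z v y \<eta>) \<in> borel_measurable (MZ \<Otimes>\<^sub>M Pi\<^sub>M v (\<lambda>_. borel))"
    and Z_gauss: "\<And>v. v \<noteq> {} \<Longrightarrow>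
      centered_gaussian_process MZ (vecs v) (Z v) (component_kernel \<sigma> k0 v)"
    and Z_indep: "prob_space.indep_vars MZ (\<lambda>v. Pi\<^sub>M (vecs v) (\<lambda>_. borel))
      (\<lambda>v \<eta>. \<lambda>y\<in>vecs v. if v = {} then Z0 \<eta> else Z v y \<eta>) UNIV"
    and \<omega>: "\<omega> \<in> space MZ"
    and K_inv: "invertible (gram_matrix k D)"
    and fc: "fc = (\<lambda>v y. posterior_component \<sigma> k0 D z f0 Z0 Z v y \<omega>)"
    and f: "f = (\<lambda>x. posterior \<sigma> k0 D z f0 Z0 Z x \<omega>)"
    and u: "u \<noteq> {}"
    and fuc: "fuc = (\<lambda>x. f x - fc u (subvec u x))"
    and var_nz: "prob_space.variance M (\<lambda>\<eta>. f (X \<eta>)) \<noteq> 0"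
    and mom4: "\<And>v. v \<noteq> {} \<Longrightarrow> integrable M (\<lambda>\<eta>. (fc v (subvec v (X \<eta>)))^4)"
    and N: "prob_space N"
    and t_indep: "prob_space.indep_vars N (\<lambda>_. borel) t UNIV"
    and t_distr: "\<And>j. distr N borel (t j) = distr M borel X"
    and U: "U = (\<lambda>\<eta>. vector [fc u (subvec u (X \<eta>)), fuc (X \<eta>), f (X \<eta>),
      (fc u (subvec u (X \<eta>)))\<^sup>2, (f (X \<eta>))\<^sup>2, fc u (subvec u (X \<eta>)) * fuc (X \<eta>)])"
    and \<mu>: "\<mu> = prob_space.expectation M U"
    and \<Gamma>: "\<Gamma> = cov_matrix M U"
  shows "weak_conv_m
    (\<lambda>m. distr N borel (\<lambda>\<eta>. sqrt (real m) *
      (sensitivity_estimator m (\<lambda>j. t j \<eta>) (\<lambda>x. fc u (subvec u x)) fuc f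
       - sensitivity M X (\<lambda>x. fc u (subvec u x)) fuc f)))
    (gaussian 0 (gradient phi \<mu> \<bullet> (\<Gamma> *v gradient phi \<mu>)))"
proof -
  interpret M: prob_space M by (rule M)
  interpret N: prob_space N by (rule N)
  define g where "g x = fc u (subvec u x)" for x
  have X [measurable]: "X \<in> borel_measurable M"
    using distributed_measurable[OF X_dens] by simp
  have "pX i \<in> borel_measurable borel" for i
  proof -
    \<comment> \<open>Measurability is known for the extended density and returns to
      \<open>pX i\<close> because \<open>pX i\<close> is nonnegative.\<close>
    have "(\<lambda>w. enn2real (ennreal (pX i w))) \<in> borel_measurable borel"
      using distributed_borel_measurable[OF pX_dens, of i] by measurable
    then show ?thesis using pX_nonneg by simp
  qed
  then have k0_meas: "(\<lambda>x. k0 i x x') \<in> borel_measurable borel" for i x'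
    unfolding k0 by (intro centered_kernel_measurable kt_meas)
  have fc_meas: "(\<lambda>x. fc v (subvec v x)) \<in> borel_measurable borel" if "v \<noteq> {}" for v
    unfolding fc
    by (rule measurable_compose[OF subvec_measurable], rule posterior_component_measurable)
      (rule k0_meas, rule Z_meas[OF that], rule \<omega>)

  define P where "P = distr M borel X"
  have iid: "iid_sample N t P"
  proof
    \<comment> \<open>\<open>P\<close> carries the Borel sigma-algebra, so composing with the
      identity changes the target space only.\<close>
    have "N.indep_vars (\<lambda>_. P) (\<lambda>j w. t j w) UNIV"
      by (rule N.indep_vars_compose2[OF t_indep]) (simp add: P_def measurable_def)
    then show "N.indep_vars (\<lambda>_. P) t UNIV" .
    show "distr N P (t j) = P" for j
      using t_distr[of j] distr_cong[of N N P borel "t j" "t j"] by (simp add: P_def)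
  qed
  interpret iid_sample N t P by (rule iid)

  have fc4: "fourth_integrable P (\<lambda>x. fc v (subvec v x))" if "v \<noteq> {}" for v
  proof -
    have pw: "(a\<^sup>2)\<^sup>2 = a^4" for a :: real by simp
    have "integrable P (\<lambda>x. (fc v (subvec v x))^4)"
      unfolding P_def using fc_meas[OF that] mom4[OF that] by (subst integrable_distr_eq) auto
    moreover have "(\<lambda>x. fc v (subvec v x)) \<in> borel_measurable P"
      using fc_meas[OF that] by (simp add: P_def)
    ultimately show ?thesis
      unfolding fourth_integrable_def square_integrable_def pw by (intro conjI borel_measurable_power)
  qed
  have g4: "fourth_integrable P g" unfolding g_def[abs_def] by (rule fc4[OF u])
  \<comment> \<open>A constant plus a finite sum: the fourth moments of the components pass to
    \<open>f\<close> and then to \<open>fuc\<close>.\<close>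
  have "f = (\<lambda>x. posterior_const \<sigma> k0 D z f0 Z0 Z \<omega> + (\<Sum>v | v \<noteq> {}. fc v (subvec v x)))"
    by (simp add: f fc posterior_def)
  then have f4: "fourth_integrable P f"
    by (simp only:) (intro fourth_integrable_add P.fourth_integrable_const fourth_integrable_sum fc4; simp)
  have h4: "fourth_integrable P fuc"
    unfolding fuc by (intro fourth_integrable_diff f4 fc4 u)
  have mP: "borel_measurable P = borel_measurable borel" by (simp add: P_def measurable_def)
  have meas [measurable]: "g \<in> borel_measurable borel" "fuc \<in> borel_measurable borel" "f \<in> borel_measurable borel"
    using g4 h4 f4 fourth_integrable_measurable by (auto simp: mP[symmetric])

  have sq: "square_integrable M (\<lambda>\<eta>. q (X \<eta>))" if "square_integrable P q" for q
    using that unfolding P_def square_integrable_def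
    by (auto simp: integrable_distr_eq intro: measurable_compose[OF X])
  note P2 = P.fourth_integrable_imp_square_integrable
  \<comment> \<open>The quadratic entries of \<open>U\<close> are where fourth moments are
    needed.\<close>
  have Ui: "square_integrable M (\<lambda>w. U w $ i)" for i
  proof -
    have "i \<in> {1, 2, 3, 4, 5, 6}" using UNIV_6 by auto
    then show ?thesis
      unfolding U using sq[OF P2[OF g4]] sq[OF P2[OF h4]] sq[OF P2[OF f4]]
        sq[OF fourth_integrable_square[OF g4]] sq[OF fourth_integrable_square[OF f4]]
        sq[OF fourth_integrable_mult[OF g4 h4]]
      by (auto simp: g_def)
  qed
  have "integrable M (\<lambda>w. \<Sum>i\<in>UNIV. U w $ i *\<^sub>R (axis i 1 :: real^6))"
    by (intro Bochner_Integration.integrable_sum integrable_scaleR_left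
        M.square_integrable_imp_integrable' Ui)
  then have Uint: "integrable M U"
    by (simp only: basis_expansion scalar_mult_eq_scaleR[symmetric])
  have \<mu>i: "\<mu> $ i = M.expectation (\<lambda>w. U w $ i)" for i
    unfolding \<mu> using integral_bounded_linear[OF bounded_linear_vec_nth Uint] by simp
  note \<mu>U = \<mu>i[of 1] \<mu>i[of 2] \<mu>i[of 3] \<mu>i[of 4] \<mu>i[of 5] \<mu>i[of 6]
  note I = M.square_integrable_imp_integrable'[OF Ui]
  note IU = I[of 1] I[of 2] I[of 3] I[of 4] I[of 5] I[of 6]
  have U_nth: "U w $ 1 = g (X w)" "U w $ 2 = fuc (X w)" "U w $ 3 = f (X w)" "U w $ 4 = (g (X w))\<^sup>2"
    "U w $ 5 = (f (X w))\<^sup>2" "U w $ 6 = g (X w) * fuc (X w)" for w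
    by (simp_all add: U g_def)
  define V where "V = M.variance (\<lambda>w. f (X w))"
  define s where "s = sensitivity M X g fuc f"
  define y where "y = sensitivity_influence M X g fuc f"
  \<comment> \<open>The variance of the model is the denominator of \<open>phi\<close> at
    \<open>\<mu>\<close>, so \<open>phi\<close> is differentiable there.\<close>
  have V: "V = \<mu> $ 5 - (\<mu> $ 3)\<^sup>2"
    unfolding V_def \<mu>U U_nth using IU by (intro M.variance_eq) (simp_all add: U_nth)
  have V0: "V \<noteq> 0" using var_nz by (simp add: V_def)
  have var_g: "M.variance (\<lambda>w. g (X w)) = \<mu> $ 4 - (\<mu> $ 1)\<^sup>2"
    unfolding \<mu>U U_nth using IU by (intro M.variance_eq) (simp_all add: U_nth)
  have cov_gh: "covar M (\<lambda>w. g (X w)) (\<lambda>w. fuc (X w)) = \<mu> $ 6 - \<mu> $ 1 * \<mu> $ 2"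
    unfolding covar_def \<mu>U U_nth using IU by (simp add: U_nth algebra_simps M.prob_space)
  have s: "s = (\<mu> $ 4 - (\<mu> $ 1)\<^sup>2 + \<mu> $ 6 - \<mu> $ 1 * \<mu> $ 2) / V"
    unfolding s_def sensitivity_def var_g cov_gh V_def by simp
  have y: "y x = ((g x - \<mu> $ 1)\<^sup>2 + (g x - \<mu> $ 1) * (fuc x - \<mu> $ 2) - s * (f x - \<mu> $ 3)\<^sup>2) / V" for x
    unfolding y_def sensitivity_influence_def \<mu>U U_nth s_def V_def by (simp add: Let_def)
  \<comment> \<open>Equivalently \<open>phi \<mu> = s\<close>; this reduces the quotients by
    \<open>V\<^sup>2\<close> in the gradient to quotients of \<open>s\<close> by
    \<open>V\<close>.\<close>
  have sn: "\<mu> $ 4 - (\<mu> $ 1)\<^sup>2 + \<mu> $ 6 - \<mu> $ 1 * \<mu> $ 2 = s * V"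
    using V0 by (simp add: s)
  have grad: "gradient phi \<mu> = vector [(- 2 * \<mu> $ 1 - \<mu> $ 2) / V, - \<mu> $ 1 / V, 2 * \<mu> $ 3 * s / V,
      1 / V, - s / V, 1 / V]"
    using V0 gradient_phi[of \<mu>] unfolding grad_phi_def Let_def V[symmetric] sn
    by (simp add: power2_eq_square mult.assoc)
  have sV: "s * \<mu> $ 5 = s * (\<mu> $ 3)\<^sup>2 + (\<mu> $ 4 - (\<mu> $ 1)\<^sup>2 + \<mu> $ 6 - \<mu> $ 1 * \<mu> $ 2)"
    unfolding sn by (simp add: V algebra_simps)
  \<comment> \<open>After expansion all terms in \<open>g\<close>, \<open>fuc\<close> and
    \<open>f\<close> cancel; the remaining constant is \<open>inverse V\<close> times the difference
    of the two sides of \<open>sV\<close>.\<close>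
  have lin: "gradient phi \<mu> \<bullet> U w - gradient phi \<mu> \<bullet> \<mu> = y (X w)" for w
  proof -
    have "gradient phi \<mu> \<bullet> U w - gradient phi \<mu> \<bullet> \<mu> - y (X w) = inverse V *
      (s * \<mu> $ 5 - (s * (\<mu> $ 3)\<^sup>2 + (\<mu> $ 4 - (\<mu> $ 1)\<^sup>2 + \<mu> $ 6 - \<mu> $ 1 * \<mu> $ 2)))"
      unfolding grad inner_vec_def sum_6 y U_nth divide_inverse
      by (simp add: algebra_simps power2_eq_square)
    then show ?thesis unfolding sV by simp
  qed
  \<comment> \<open>By \<open>lin\<close> the centred variable is \<open>y (X w)\<close>, so the
    quadratic form is the second moment occurring in the limit theorem.\<close>
  have "gradient phi \<mu> \<bullet> (\<Gamma> *v gradient phi \<mu>) = M.variance (\<lambda>w. gradient phi \<mu> \<bullet> U w)"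
    unfolding \<Gamma> by (rule M.inner_cov_matrix[OF Ui])
  also have "M.expectation (\<lambda>w. gradient phi \<mu> \<bullet> U w) = gradient phi \<mu> \<bullet> \<mu>"
    unfolding \<mu> using Uint by (rule_tac integral_inner_right)
  finally have limit: "gradient phi \<mu> \<bullet> (\<Gamma> *v gradient phi \<mu>) = M.expectation (\<lambda>w. (y (X w))\<^sup>2)"
    by (simp only: lin)
  have [measurable]: "y \<in> borel_measurable borel" unfolding y[abs_def] by measurable
  have "P.variance f \<noteq> 0" using var_nz by (simp add: P_def integral_distr)
  from sensitivity_estimator_clt[OF g4 h4 f4 this] show ?thesis
    unfolding limit P_def
    by (simp add: sensitivity_distr sensitivity_influence_distr integral_distr y_def[symmetric] g_def[abs_def, symmetric])
qed

end
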